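(* Let $N$ be a connected non-compact nilpotent Lie group and $\mathfrak{n}$ its Lie algebra. Then the set of $X\in\mathfrak{n}$ generating a non-precompact one-parameter group is dense in $\mathfrak{n}$.
   Context: Lie groups are real and finite-dimensional. $X$ generates a non-precompact one-parameter group if $\{\exp(tX)\}_{t\in\mathbb{R}}$ does not have compact closure in $N$. *)

theory Defs
  imports "HOL-Analysis.Analysis" "HOL-Algebra.Generated_Groups"
begin

section \<open>Smooth maps between open subsets of Euclidean spaces\<close>

text \<open>Only meant for open sets \<open>S\<close>: the derivatives are taken in the full space. Order \<open>Suc n\<close>
  asks for differentiability and for every directional derivative to be of order \<open>n\<close>; in finite
  dimension this is the class \<open>C\<^sup>n\<close> on \<open>S\<close>.\<close>

primrec Ck_on :: "nat \<Rightarrow> 'a::real_normed_vector set \<Rightarrow> ('a \<Rightarrow> 'b::real_normed_vector) \<Rightarrow> bool"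
  where
    "Ck_on 0 S f \<longleftrightarrow> continuous_on S f"
  | "Ck_on (Suc n) S f \<longleftrightarrow> (\<forall>x\<in>S. f differentiable (at x)) \<and>
       (\<forall>v. Ck_on n S (\<lambda>x. frechet_derivative f (at x) v))"

definition smooth_on :: "'a::real_normed_vector set \<Rightarrow> ('a \<Rightarrow> 'b::real_normed_vector) \<Rightarrow> bool"
  where "smooth_on S f \<longleftrightarrow> (\<forall>n. Ck_on n S f)"

section \<open>Smooth manifolds\<close>

text \<open>A chart is a pair \<open>(U, \<phi>)\<close> of a domain and a coordinate map; the values of \<open>\<phi>\<close> outside \<open>U\<close>
  are irrelevant, and its inverse is \<open>inv_into U \<phi>\<close>. The model space is a Euclidean space \<open>'e\<close>, so
  manifolds are of pure dimension \<open>DIM('e) \<ge> 1\<close>. Atlases need not be maximal.\<close>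

type_synonym ('a, 'e) chart = "'a set \<times> ('a \<Rightarrow> 'e)"

definition is_chart :: "'a topology \<Rightarrow> ('a, 'e::euclidean_space) chart \<Rightarrow> bool"
  where "is_chart T = (\<lambda>(U, \<phi>). openin T U \<and> open (\<phi> ` U) \<and>
           homeomorphic_map (subtopology T U) (top_of_set (\<phi> ` U)) \<phi>)"

definition smooth_manifold :: "'a topology \<Rightarrow> ('a, 'e::euclidean_space) chart set \<Rightarrow> bool"
  where "smooth_manifold T A \<longleftrightarrow>
           Hausdorff_space T \<and> second_countable T \<and>
           (\<forall>c\<in>A. is_chart T c) \<and> \<Union> (fst ` A) = topspace T \<and>
           (\<forall>(U, \<phi>)\<in>A. \<forall>(V, \<psi>)\<in>A. smooth_on (\<phi> ` (U \<inter> V)) (\<psi> \<circ> inv_into U \<phi>))"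

definition smooth_map ::
    "'a topology \<Rightarrow> ('a, 'd::euclidean_space) chart set \<Rightarrow>
     'b topology \<Rightarrow> ('b, 'e::euclidean_space) chart set \<Rightarrow> ('a \<Rightarrow> 'b) \<Rightarrow> bool"
  where "smooth_map S A T B f \<longleftrightarrow> continuous_map S T f \<and>
           (\<forall>(U, \<phi>)\<in>A. \<forall>(V, \<psi>)\<in>B. smooth_on (\<phi> ` (U \<inter> f -` V)) (\<psi> \<circ> f \<circ> inv_into U \<phi>))"

definition prod_atlas ::
    "('a, 'd) chart set \<Rightarrow> ('b, 'e) chart set \<Rightarrow> ('a \<times> 'b, 'd \<times> 'e) chart set"
  where "prod_atlas A B = {(U \<times> V, map_prod \<phi> \<psi>) | U \<phi> V \<psi>. (U, \<phi>) \<in> A \<and> (V, \<psi>) \<in> B}"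

definition real_atlas :: "(real, real) chart set"
  where "real_atlas = {(UNIV, id)}"

text \<open>A tangent vector at \<open>p\<close> is the family of its coordinate vectors in the charts around \<open>p\<close>,
  transforming by the derivatives of the transition maps; components at all other indices are
  set to \<open>0\<close>. The vector space operations are pointwise. The topology of pointwise convergence on
  families restricts to the usual topology of the finite-dimensional space of tangent vectors,
  because one component at a chart around \<open>p\<close> determines all the others linearly.\<close>

type_synonym ('a, 'e) tangent_vector = "('a, 'e) chart \<Rightarrow> 'e"

definition tangent_space ::
    "('a, 'e::euclidean_space) chart set \<Rightarrow> 'a \<Rightarrow> ('a, 'e) tangent_vector set"
  where "tangent_space A p =
           {X. (\<forall>c. \<not> (c \<in> A \<and> p \<in> fst c) \<longrightarrow> X c = 0) \<and>
               (\<forall>(U, \<phi>)\<in>A. \<forall>(V, \<psi>)\<in>A. p \<in> U \<and> p \<in> V \<longrightarrow>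
                  X (V, \<psi>) = frechet_derivative (\<psi> \<circ> inv_into U \<phi>) (at (\<phi> p)) (X (U, \<phi>)))}"

definition scale_tangent ::
    "real \<Rightarrow> ('a, 'e::euclidean_space) tangent_vector \<Rightarrow> ('a, 'e) tangent_vector"
  where "scale_tangent t X = (\<lambda>c. t *\<^sub>R X c)"

definition velocity ::
    "('a, 'e::euclidean_space) chart set \<Rightarrow> (real \<Rightarrow> 'a) \<Rightarrow> real \<Rightarrow> ('a, 'e) tangent_vector"
  where "velocity A \<gamma> t =
           (\<lambda>(U, \<phi>). if (U, \<phi>) \<in> A \<and> \<gamma> t \<in> U then vector_derivative (\<phi> \<circ> \<gamma>) (at t) else 0)"

section \<open>Lie groups\<close>

locale lie_group = group G
  for G :: "('a, 'm) monoid_scheme" (structure)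
    and T :: "'a topology"
    and A :: "('a, 'e::euclidean_space) chart set" +
  assumes topspace_eq: "topspace T = carrier G"
    and manifold: "smooth_manifold T A"
    and smooth_mult:
      "smooth_map (prod_topology T T) (prod_atlas A A) T A (\<lambda>(x, y). x \<otimes> y)"
    and smooth_inv: "smooth_map T A T A (\<lambda>x. inv x)"

text \<open>The underlying space of the Lie algebra, as the tangent space at the identity. The bracket
  is not needed: nilpotency is defined on the group below.\<close>

definition lie_algebra ::
    "('a, 'm) monoid_scheme \<Rightarrow> ('a, 'e::euclidean_space) chart set \<Rightarrow> ('a, 'e) tangent_vector set"
  where "lie_algebra G A = tangent_space A \<one>\<^bsub>G\<^esub>"

definition one_parameter_subgroup ::
    "('a, 'm) monoid_scheme \<Rightarrow> 'a topology \<Rightarrow> ('a, 'e::euclidean_space) chart set \<Rightarrow>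
     (real \<Rightarrow> 'a) \<Rightarrow> bool"
  where "one_parameter_subgroup G T A \<gamma> \<longleftrightarrow>
           smooth_map euclideanreal real_atlas T A \<gamma> \<and> (\<forall>s t. \<gamma> (s + t) = \<gamma> s \<otimes>\<^bsub>G\<^esub> \<gamma> t)"

definition lie_exp ::
    "('a, 'm) monoid_scheme \<Rightarrow> 'a topology \<Rightarrow> ('a, 'e::euclidean_space) chart set \<Rightarrow>
     ('a, 'e) tangent_vector \<Rightarrow> 'a"
  where "lie_exp G T A X =
           (THE \<gamma>. one_parameter_subgroup G T A \<gamma> \<and> velocity A \<gamma> 0 = X) 1"

definition nonprecompact_generator ::
    "('a, 'm) monoid_scheme \<Rightarrow> 'a topology \<Rightarrow> ('a, 'e::euclidean_space) chart set \<Rightarrow>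
     ('a, 'e) tangent_vector \<Rightarrow> bool"
  where "nonprecompact_generator G T A X \<longleftrightarrow>
           \<not> compactin T (T closure_of range (\<lambda>t::real. lie_exp G T A (scale_tangent t X)))"

section \<open>Nilpotent groups\<close>

primrec lower_central_series :: "('a, 'm) monoid_scheme \<Rightarrow> nat \<Rightarrow> 'a set"
  where
    "lower_central_series G 0 = carrier G"
  | "lower_central_series G (Suc n) = generate G
       {x \<otimes>\<^bsub>G\<^esub> y \<otimes>\<^bsub>G\<^esub> inv\<^bsub>G\<^esub> x \<otimes>\<^bsub>G\<^esub> inv\<^bsub>G\<^esub> y | x y.
          x \<in> lower_central_series G n \<and> y \<in> carrier G}"

definition nilpotent_group :: "('a, 'm) monoid_scheme \<Rightarrow> bool"
  where "nilpotent_group G \<longleftrightarrow> (\<exists>n. lower_central_series G n = {\<one>\<^bsub>G\<^esub>})"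

end

theory Submission
  imports Defs
begin

text \<open>
  Suppose that the nonprecompact generators are not dense. Then all \<open>X\<close> in some nonempty open set
  of the Lie algebra have precompact one-parameter groups, and the point is to conclude that the
  whole group is compact.

  First, a subgroup \<open>H\<close> contained in a compact set is central
  (\<open>precompact_subgroup_central\<close>). The proof goes up the lower central series from its trivial
  term. Suppose that all elements of one term that are close to the identity commute with \<open>H\<close>, and
  let \<open>z\<close> be in the preceding term. By compactness, if \<open>z\<close> is close to the identity, then so is \<open>[z, k]\<close> for every \<open>k \<in> H\<close>, so \<open>[z, k]\<close> commutes with
  \<open>H\<close>. Hence \<open>[z, k]\<^sup>n = [z, k\<^sup>n]\<close> stays close to the identity for all \<open>n\<close>, and as a Lie
  group has no small subgroups, \<open>[z, k] = 1\<close>. At the top of the series, a whole neighbourhood of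
  the identity centralizes \<open>H\<close>, and a neighbourhood generates a connected group.

  Second, the vectors with central precompact one-parameter group are a linear subspace, because
  \<open>exp (X + Y) = exp X exp Y\<close> for commuting factors. As it contains a nonempty open set, it is the
  whole Lie algebra. So \<open>exp\<close> is a homomorphism; its image contains a neighbourhood of the
  identity, hence everything, and is a product of finitely many precompact
  one-parameter groups. So the group is compact (\<open>open_precompact_imp_compact\<close>).

  The exponential map is built without differential equations, from a single consequence of
  differentiability: in coordinates \<open>\<xi>\<close> that vanish at the identity, \<open>\<xi> (g h) - \<xi> g - \<xi> h\<close> has
  arbitrarily small Lipschitz constant near the identity. This gives the stability estimate
  \<open>norm (\<xi> (a\<^sup>k) - \<xi> (b\<^sup>k)) \<le> 4 k norm (\<xi> a - \<xi> b)\<close> for short powers (\<open>pow_stability\<close>). It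
  follows that the \<open>n\<close>-th powers of the elements with coordinates \<open>v / n\<close> converge, and that their
  limit only depends on the first order behaviour of the roots (\<open>pow_limit\<close>). Applied to inverses
  and products of roots, the latter fact gives the laws of \<open>exp\<close>; applied to the roots \<open>\<gamma> (t / n)\<close>
  of \<open>\<gamma> t\<close>, it gives the uniqueness of one-parameter subgroups (\<open>Exp_unique\<close>).
  Smoothness of \<open>t \<mapsto> exp (t v)\<close> in an arbitrary chart comes last: the curve solves an autonomous
  equation with smooth right-hand side (\<open>integral_curve_smooth\<close>).
\<close>

section \<open>Calculus of \<open>C\<^sup>n\<close> maps\<close>

lemma Ck_on_cong:
  assumes "open S" "\<And>x. x \<in> S \<Longrightarrow> f x = g x" "Ck_on n S f"
  shows "Ck_on n S g"
  using assms(2,3)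
proof (induction n arbitrary: f g)
  case 0
  then show ?case by (simp cong: continuous_on_cong)
next
  case (Suc n)
  have d: "f differentiable (at x)" if "x \<in> S" for x using Suc.prems that by simp
  have fd: "frechet_derivative f (at x) = frechet_derivative g (at x)" if x: "x \<in> S" for x
    by (rule frechet_derivative_transform_within_open[OF d[OF x] \<open>open S\<close> x Suc.prems(1)])
  have dg: "g differentiable (at x)" if x: "x \<in> S" for x
    using has_derivative_transform_within_open[OF frechet_derivative_works[THEN iffD1, OF d[OF x]] \<open>open S\<close> x Suc.prems(1)]
    by (rule differentiableI)
  have "Ck_on n S (\<lambda>x. frechet_derivative g (at x) v)" for v
    by (rule Suc.IH[of "\<lambda>x. frechet_derivative f (at x) v"]) (use fd Suc.prems in auto)
  then show ?case using dg by simp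
qed

lemma Ck_on_Suc_iff_has_derivative:
  assumes "open S" and d: "\<And>x. x \<in> S \<Longrightarrow> (f has_derivative f' x) (at x)"
  shows "Ck_on (Suc n) S f \<longleftrightarrow> (\<forall>v. Ck_on n S (\<lambda>x. f' x v))"
proof -
  have eq: "frechet_derivative f (at x) v = f' x v" if "x \<in> S" for x v
    using frechet_derivative_at[OF d[OF that]] by simp
  have "Ck_on n S (\<lambda>x. frechet_derivative f (at x) v) \<longleftrightarrow> Ck_on n S (\<lambda>x. f' x v)" for v
    by (rule iffI; rule Ck_on_cong[OF \<open>open S\<close>, rotated], assumption) (simp_all add: eq)
  then show ?thesis using d differentiableI by (simp add: differentiableI[OF d]) 
qed

lemma Ck_on_has_derivative:
  assumes "Ck_on (Suc n) S f" "x \<in> S"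
  shows "(f has_derivative frechet_derivative f (at x)) (at x)"
  using assms by (simp add: frechet_derivative_works[symmetric])

lemma Ck_on_SucD: "Ck_on (Suc n) S f \<Longrightarrow> Ck_on n S f"
proof (induction n arbitrary: f)
  case 0
  then show ?case
    by (auto intro!: continuous_at_imp_continuous_on differentiable_imp_continuous_within)
next
  case (Suc n)
  have "f differentiable (at x)" if "x \<in> S" for x using Suc.prems that by simp
  moreover have "Ck_on n S (\<lambda>x. frechet_derivative f (at x) v)" for v
    by (rule Suc.IH) (use Suc.prems in \<open>unfold Ck_on.simps(2)[of "Suc n"], blast\<close>)
  ultimately show ?case by simp
qed

lemma Ck_on_const: "Ck_on n S (\<lambda>_. c)"
  by (induction n arbitrary: c) auto

lemma Ck_on_ident: "open S \<Longrightarrow> Ck_on n S (\<lambda>x. x)"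
  by (cases n) (auto simp del: Ck_on.simps(2)
      simp: Ck_on_Suc_iff_has_derivative[where f' = "\<lambda>_ v. v"] Ck_on_const continuous_on_id)

lemma Ck_on_add:
  assumes "open S" "Ck_on n S f" "Ck_on n S g"
  shows "Ck_on n S (\<lambda>x. f x + g x)"
  using assms(2,3)
proof (induction n arbitrary: f g)
  case 0
  then show ?case by (simp add: continuous_on_add)
next
  case (Suc n)
  have "Ck_on n S (\<lambda>x. frechet_derivative f (at x) v + frechet_derivative g (at x) v)" for v
    by (rule Suc.IH) (use Suc.prems in auto)
  then show ?case
    by (subst Ck_on_Suc_iff_has_derivative[OF assms(1) has_derivative_add[OF
          Ck_on_has_derivative[OF Suc.prems(1)] Ck_on_has_derivative[OF Suc.prems(2)]]]) auto
qed

lemma Ck_on_sum: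
  assumes "open S" "\<And>i. i \<in> I \<Longrightarrow> Ck_on n S (f i)"
  shows "Ck_on n S (\<lambda>x. \<Sum>i\<in>I. f i x)"
proof (cases "finite I")
  case True
  then show ?thesis using assms(2)
    by (induction I rule: finite_induct) (auto simp: Ck_on_const intro!: Ck_on_add[OF assms(1)])
qed (simp add: Ck_on_const)

lemma Ck_on_scaleR:
  fixes a :: "'a::real_normed_vector \<Rightarrow> real" and f :: "'a \<Rightarrow> 'b::real_normed_vector"
  assumes "open S" "Ck_on n S a" "Ck_on n S f"
  shows "Ck_on n S (\<lambda>x. a x *\<^sub>R f x)"
  using assms(2,3)
proof (induction n arbitrary: a f)
  case 0
  then show ?case by (simp add: continuous_on_scaleR)
next
  case (Suc n)
  have "Ck_on n S (\<lambda>x. a x *\<^sub>R frechet_derivative f (at x) v)" for v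
    by (rule Suc.IH) (use Suc.prems Ck_on_SucD[OF Suc.prems(1)] in auto)
  moreover have "Ck_on n S (\<lambda>x. frechet_derivative a (at x) v *\<^sub>R f x)" for v
    by (rule Suc.IH) (use Suc.prems Ck_on_SucD[OF Suc.prems(2)] in auto)
  ultimately have "Ck_on n S (\<lambda>x. a x *\<^sub>R frechet_derivative f (at x) v + frechet_derivative a (at x) v *\<^sub>R f x)" for v
    by (intro Ck_on_add[OF assms(1)])
  then show ?case
    by (subst Ck_on_Suc_iff_has_derivative[OF assms(1) has_derivative_scaleR[OF
          Ck_on_has_derivative[OF Suc.prems(1)] Ck_on_has_derivative[OF Suc.prems(2)]]]) auto
qed

lemma Ck_on_bounded_linear:
  assumes "open S" "bounded_linear L" "Ck_on n S f"
  shows "Ck_on n S (\<lambda>x. L (f x))"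
  using assms(3)
proof (induction n arbitrary: f)
  case 0
  then show ?case by (simp add: bounded_linear.continuous_on[OF assms(2)])
next
  case (Suc n)
  have "Ck_on n S (\<lambda>x. L (frechet_derivative f (at x) v))" for v
    by (rule Suc.IH) (use Suc.prems in auto)
  then show ?case
    by (subst Ck_on_Suc_iff_has_derivative[OF assms(1)
          bounded_linear.has_derivative[OF assms(2) Ck_on_has_derivative[OF Suc.prems]]]) auto
qed

lemma smooth_on_directional_derivative:
  "smooth_on S f \<Longrightarrow> smooth_on S (\<lambda>x. frechet_derivative f (at x) v)"
  unfolding smooth_on_def by (metis Ck_on.simps(2))

lemma smooth_on_has_derivative:
  "smooth_on S f \<Longrightarrow> x \<in> S \<Longrightarrow> (f has_derivative frechet_derivative f (at x)) (at x)"
  unfolding smooth_on_def using Ck_on_has_derivative by blast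

text \<open>Expanding \<open>F\<close> in the standard basis gives a finite sum of products of components of \<open>F\<close> with
  partial derivatives of \<open>g\<close>, to which the product rule applies.\<close>

lemma smooth_on_derivative_along_field:
  fixes F :: "'a::euclidean_space \<Rightarrow> 'a" and g :: "'a \<Rightarrow> 'b::real_normed_vector"
  assumes "open S" "smooth_on S F" "smooth_on S g"
  shows "smooth_on S (\<lambda>u. frechet_derivative g (at u) (F u))"
  unfolding smooth_on_def
proof
  fix n
  have "Ck_on n S (\<lambda>u. \<Sum>b\<in>Basis. (F u \<bullet> b) *\<^sub>R frechet_derivative g (at u) b)"
    using assms smooth_on_directional_derivative[OF assms(3)] unfolding smooth_on_def
    by (intro Ck_on_sum Ck_on_scaleR Ck_on_bounded_linear[OF _ bounded_linear_inner_left]) auto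
  then show "Ck_on n S (\<lambda>u. frechet_derivative g (at u) (F u))"
  proof (rule Ck_on_cong[OF assms(1), rotated])
    fix u assume "u \<in> S"
    then have "linear (frechet_derivative g (at u))"
      using smooth_on_has_derivative[OF assms(3)] has_derivative_linear by blast
    then have "frechet_derivative g (at u) (\<Sum>b\<in>Basis. (F u \<bullet> b) *\<^sub>R b)
        = (\<Sum>b\<in>Basis. (F u \<bullet> b) *\<^sub>R frechet_derivative g (at u) b)"
      by (simp add: linear_sum linear_scale)
    then show "(\<Sum>b\<in>Basis. (F u \<bullet> b) *\<^sub>R frechet_derivative g (at u) b)
        = frechet_derivative g (at u) (F u)"
      by (simp add: euclidean_representation)
  qed
qed

text \<open>By the chain rule, the derivative of \<open>g \<circ> y\<close> is \<open>h \<circ> y\<close>, where \<open>h\<close> is the derivative of \<open>g\<close>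
  along \<open>F\<close> and again smooth. Hence an induction on the order, for all smooth \<open>g\<close> at once, reduces
  smoothness to the continuity of \<open>y\<close>.\<close>

lemma integral_curve_smooth:
  fixes y :: "real \<Rightarrow> 'e::euclidean_space"
  assumes I: "open I" and S: "open S" and y: "\<And>t. t \<in> I \<Longrightarrow> y t \<in> S"
    and F: "smooth_on S F"
    and deriv: "\<And>t. t \<in> I \<Longrightarrow> (y has_vector_derivative F (y t)) (at t)"
  shows "smooth_on I y"
proof -
  have cont: "continuous_on I y"
    by (intro continuous_at_imp_continuous_on ballI has_vector_derivative_continuous[OF deriv])
  have "Ck_on n I (\<lambda>t. g (y t))" if "smooth_on S g" for n and g :: "'e \<Rightarrow> 'e"
    using that
  proof (induction n arbitrary: g)
    case 0
    then have "continuous_on S g" unfolding smooth_on_def by (metis Ck_on.simps(1))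
    then have "continuous_on I (\<lambda>t. g (y t))"
      using continuous_on_compose2[OF _ cont] y by blast
    then show ?case by simp
  next
    case (Suc n)
    have d: "((\<lambda>t. g (y t)) has_derivative (\<lambda>s. frechet_derivative g (at (y t)) (s *\<^sub>R F (y t)))) (at t)"
      if t: "t \<in> I" for t
      using has_derivative_compose[OF deriv[OF t, unfolded has_vector_derivative_def]
          smooth_on_has_derivative[OF Suc.prems y[OF t]]] .
    have "Ck_on n I (\<lambda>t. s *\<^sub>R frechet_derivative g (at (y t)) (F (y t)))" for s
      by (intro Ck_on_scaleR I Ck_on_const Suc.IH smooth_on_derivative_along_field[OF S F Suc.prems])
    then have "Ck_on n I (\<lambda>t. frechet_derivative g (at (y t)) (s *\<^sub>R F (y t)))" for s
    proof (rule Ck_on_cong[OF I, rotated])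
      fix t assume "t \<in> I"
      then have "linear (frechet_derivative g (at (y t)))"
        using smooth_on_has_derivative[OF Suc.prems y] has_derivative_linear by blast
      then show "s *\<^sub>R frechet_derivative g (at (y t)) (F (y t))
          = frechet_derivative g (at (y t)) (s *\<^sub>R F (y t))"
        by (simp add: linear_scale)
    qed
    then show ?case by (subst Ck_on_Suc_iff_has_derivative[OF I d]) auto
  qed
  from this[of "\<lambda>x. x"] show ?thesis
    using Ck_on_ident[OF S] by (simp add: smooth_on_def)
qed

text \<open>The partial derivatives of the slice are derivatives of \<open>M\<close> in the directions \<open>(w, 0)\<close>, so the
  induction is over all \<open>M\<close>.\<close>

lemma smooth_on_slice:
  assumes S: "open S" and "\<And>u. u \<in> S \<Longrightarrow> (u, c) \<in> \<Omega>" and "smooth_on \<Omega> M"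
  shows "smooth_on S (\<lambda>u. M (u, c))"
proof -
  have "Ck_on n S (\<lambda>u. M (u, c))" if "Ck_on n \<Omega> M" for n
    using that
  proof (induction n arbitrary: M)
    case 0
    have "continuous_on S (\<lambda>u. (u, c))" by (intro continuous_intros)
    then have "continuous_on S (\<lambda>u. M (u, c))"
      using 0 assms(2) by (auto intro: continuous_on_compose2)
    then show ?case by simp
  next
    case (Suc n)
    have d: "((\<lambda>u. M (u, c)) has_derivative (\<lambda>w. frechet_derivative M (at (u, c)) (w, 0))) (at u)"
      if u: "u \<in> S" for u
    proof -
      have "((\<lambda>u. (u, c)) has_derivative (\<lambda>w. (w, 0))) (at u)"
        by (intro derivative_intros)
      from has_derivative_compose[OF this Ck_on_has_derivative[OF Suc.prems assms(2)[OF u]]]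
      show ?thesis .
    qed
    have "Ck_on n S (\<lambda>u. frechet_derivative M (at (u, c)) (w, 0))" for w
      by (rule Suc.IH) (use Suc.prems in auto)
    then show ?case by (subst Ck_on_Suc_iff_has_derivative[OF S d]) auto
  qed
  then show ?thesis using assms(3) by (simp add: smooth_on_def)
qed

text \<open>This is the mean value inequality for \<open>f\<close> minus its linear part at \<open>x0\<close>. The operator norm of
  the derivative of the difference is bounded by its values on the basis vectors, and only these
  are known to be continuous.\<close>

lemma C1_strictly_differentiable:
  fixes f :: "'a::euclidean_space \<Rightarrow> 'b::real_normed_vector"
  assumes f: "Ck_on (Suc 0) S f" and r: "r > 0" "ball x0 r \<subseteq> S" and e: "e > 0"
  obtains d where "d > 0" "d \<le> r"
    "\<And>x y. x \<in> ball x0 d \<Longrightarrow> y \<in> ball x0 d \<Longrightarrow>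
      norm (f x - f y - frechet_derivative f (at x0) (x - y)) \<le> e * norm (x - y)"
proof -
  let ?D = "\<lambda>x. frechet_derivative f (at x)"
  let ?e = "e / real DIM('a)"
  have x0: "x0 \<in> ball x0 r" using r by simp
  have "\<forall>\<^sub>F x in at x0. \<forall>b\<in>Basis. norm (?D x b - ?D x0 b) < ?e"
  proof (rule eventually_ball_finite[OF finite_Basis], intro ballI)
    fix b :: 'a
    have "continuous_on S (\<lambda>x. ?D x b)" using f by simp
    then have "continuous_on (ball x0 r) (\<lambda>x. ?D x b)" using r(2) by (rule continuous_on_subset)
    then have "((\<lambda>x. ?D x b) \<longlongrightarrow> ?D x0 b) (at x0)"
      using x0 by (simp add: continuous_on_eq_continuous_at isCont_def)
    from tendstoD[OF this, of ?e] show "\<forall>\<^sub>F x in at x0. norm (?D x b - ?D x0 b) < ?e"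
      using e by (simp add: dist_norm)
  qed
  then obtain d where d: "d > 0" "\<And>x b. x \<noteq> x0 \<Longrightarrow> dist x x0 < d \<Longrightarrow> b \<in> Basis \<Longrightarrow> norm (?D x b - ?D x0 b) < ?e"
    unfolding eventually_at by blast
  have Dn: "norm (?D x b - ?D x0 b) \<le> ?e" if "x \<in> ball x0 d" "b \<in> Basis" for x b
    using d(2)[of x b] that e by (cases "x = x0") (auto simp: dist_commute intro: less_imp_le)
  have der: "(f has_derivative ?D x) (at x)" if "x \<in> ball x0 r" for x
    using Ck_on_has_derivative[OF f] that r by blast
  have bl: "bounded_linear (?D x)" if "x \<in> ball x0 r" for x
    using der[OF that] by (rule has_derivative_bounded_linear)
  show thesis
  proof (rule that[of "min d r"])
    fix x y assume xy: "x \<in> ball x0 (min d r)" "y \<in> ball x0 (min d r)"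
    have "norm ((f x - ?D x0 x) - (f y - ?D x0 y)) \<le> e * norm (x - y)"
    proof (rule differentiable_bound[OF convex_ball _ _ xy])
      fix z assume z: "z \<in> ball x0 (min d r)"
      have "((\<lambda>z. f z - ?D x0 z) has_derivative (\<lambda>h. ?D z h - ?D x0 h)) (at z)"
        using z by (intro has_derivative_diff der bounded_linear_imp_has_derivative bl x0) auto
      then show "((\<lambda>z. f z - ?D x0 z) has_derivative (\<lambda>h. ?D z h - ?D x0 h)) (at z within ball x0 (min d r))"
        by (rule has_derivative_at_withinI)
      have "onorm (\<lambda>h. ?D z h - ?D x0 h) \<le> (\<Sum>b\<in>Basis. norm (?D z b - ?D x0 b))"
        by (rule onorm_componentwise) (use z x0 in \<open>auto intro!: bounded_linear_sub bl\<close>)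
      also have "\<dots> \<le> (\<Sum>b\<in>(Basis :: 'a set). ?e)" by (rule sum_mono) (use Dn z in auto)
      also have "\<dots> = e" by simp
      finally show "onorm (\<lambda>h. ?D z h - ?D x0 h) \<le> e" .
    qed
    moreover have "?D x0 (x - y) = ?D x0 x - ?D x0 y"
      using linear_diff[OF bounded_linear.linear[OF bl[OF x0]]] .
    moreover have "f x - f y - (?D x0 x - ?D x0 y) = (f x - ?D x0 x) - (f y - ?D x0 y)" by simp
    ultimately show "norm (f x - f y - ?D x0 (x - y)) \<le> e * norm (x - y)"
      by (simp only:)
  qed (use d r in auto)
qed

section \<open>Powers near the identity\<close>

text \<open>The coordinate expression of \<open>f\<close> minus the addition is \<open>\<epsilon>\<close>-Lipschitz on the ball of radius \<open>\<delta>\<close>.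
  For a multiplication \<open>f\<close>, having this for all \<open>\<epsilon>\<close> (with \<open>\<delta>\<close> depending on \<open>\<epsilon>\<close>) is strict
  differentiability at the identity, with addition as derivative.\<close>

definition strict_approx :: "('a \<Rightarrow> 'e::real_normed_vector) \<Rightarrow> ('a \<Rightarrow> 'a \<Rightarrow> 'a) \<Rightarrow> 'a set \<Rightarrow> real \<Rightarrow> real \<Rightarrow> bool"
  where "strict_approx \<xi> f U \<epsilon> \<delta> \<longleftrightarrow>
    (\<forall>g\<in>U. \<forall>h\<in>U. \<forall>g'\<in>U. \<forall>h'\<in>U.
      norm (\<xi> g) < \<delta> \<longrightarrow> norm (\<xi> h) < \<delta> \<longrightarrow> norm (\<xi> g') < \<delta> \<longrightarrow> norm (\<xi> h') < \<delta> \<longrightarrow>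
      f g h \<in> U \<and>
      norm (\<xi> (f g h) - \<xi> (f g' h') - (\<xi> g - \<xi> g') - (\<xi> h - \<xi> h'))
        \<le> \<epsilon> * (norm (\<xi> g - \<xi> g') + norm (\<xi> h - \<xi> h')))"

text \<open>A topological group with coordinates \<open>\<xi>\<close> on a neighbourhood \<open>U\<close> of the identity. Balls in the
  coordinates form a neighbourhood base at the identity; this and the strict differentiability of the multiplication
  are all that the construction of the exponential map uses.\<close>

locale coordinate_group = group G
  for G :: "('a, 'm) monoid_scheme" (structure)
    and T :: "'a topology"
    and U :: "'a set"
    and \<xi> :: "'a \<Rightarrow> 'e::euclidean_space" +
  assumes topspace_carrier: "topspace T = carrier G"
    and mult_continuous: "continuous_map (prod_topology T T) T (\<lambda>(x, y). x \<otimes> y)"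
    and inv_continuous: "continuous_map T T (\<lambda>x. inv x)"
    and one_in: "\<one> \<in> U" and coord_one: "\<xi> \<one> = 0"
    and coord_inj: "inj_on \<xi> U"
    and coord_surj: "\<exists>r>0. ball 0 r \<subseteq> \<xi> ` U"
    and open_coord_ball: "\<delta> > 0 \<Longrightarrow> openin T {g \<in> U. norm (\<xi> g) < \<delta>}"
    and coord_ball_nbhd:
      "openin T W \<Longrightarrow> \<one> \<in> W \<Longrightarrow> \<exists>\<delta>>0. {g \<in> U. norm (\<xi> g) < \<delta>} \<subseteq> W"
    and U_carrier: "U \<subseteq> carrier G"
    and strict: "\<epsilon> > 0 \<Longrightarrow> \<exists>\<delta>>0. strict_approx \<xi> (\<otimes>) U \<epsilon> \<delta>"
begin

lemma in_carrier [simp, intro]: "g \<in> U \<Longrightarrow> g \<in> carrier G"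
  using U_carrier by blast

lemma coord_eqD: "g \<in> U \<Longrightarrow> h \<in> U \<Longrightarrow> \<xi> g = \<xi> h \<Longrightarrow> g = h"
  using coord_inj by (auto dest: inj_onD)

lemma strict_approxD:
  assumes "strict_approx \<xi> (\<otimes>) U \<epsilon> \<delta>" "g \<in> U" "h \<in> U" "g' \<in> U" "h' \<in> U"
    "norm (\<xi> g) < \<delta>" "norm (\<xi> h) < \<delta>" "norm (\<xi> g') < \<delta>" "norm (\<xi> h') < \<delta>"
  shows "g \<otimes> h \<in> U"
    and "norm (\<xi> (g \<otimes> h) - \<xi> (g' \<otimes> h') - (\<xi> g - \<xi> g') - (\<xi> h - \<xi> h'))
        \<le> \<epsilon> * (norm (\<xi> g - \<xi> g') + norm (\<xi> h - \<xi> h'))"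
  using assms unfolding strict_approx_def by blast+

lemma strict_approx_mono:
  assumes "strict_approx \<xi> (\<otimes>) U \<epsilon> \<delta>" "\<delta>' \<le> \<delta>"
  shows "strict_approx \<xi> (\<otimes>) U \<epsilon> \<delta>'"
  using assms unfolding strict_approx_def by (meson order_less_le_trans)

lemma mult_in_U:
  assumes "strict_approx \<xi> (\<otimes>) U \<epsilon> \<delta>" "g \<in> U" "h \<in> U" "norm (\<xi> g) < \<delta>" "norm (\<xi> h) < \<delta>"
  shows "g \<otimes> h \<in> U"
  using strict_approxD(1)[OF assms(1,2,3,2,3)] assms by blast

lemma mult_lipschitz_left:
  assumes s: "strict_approx \<xi> (\<otimes>) U \<epsilon> \<delta>" and "g \<in> U" "g' \<in> U" "h \<in> U"
    and "norm (\<xi> g) < \<delta>" "norm (\<xi> g') < \<delta>" "norm (\<xi> h) < \<delta>"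
  shows "norm (\<xi> (g \<otimes> h) - \<xi> (g' \<otimes> h) - (\<xi> g - \<xi> g')) \<le> \<epsilon> * norm (\<xi> g - \<xi> g')"
  using strict_approxD(2)[OF s, of g h g' h] assms by simp

lemma mult_lipschitz_right:
  assumes s: "strict_approx \<xi> (\<otimes>) U \<epsilon> \<delta>" and "g \<in> U" "h \<in> U" "h' \<in> U"
    and "norm (\<xi> g) < \<delta>" "norm (\<xi> h) < \<delta>" "norm (\<xi> h') < \<delta>"
  shows "norm (\<xi> (g \<otimes> h) - \<xi> (g \<otimes> h') - (\<xi> h - \<xi> h')) \<le> \<epsilon> * norm (\<xi> h - \<xi> h')"
  using strict_approxD(2)[OF s, of g h g h'] assms by simp

lemma mult_almost_add:
  assumes s: "strict_approx \<xi> (\<otimes>) U \<epsilon> \<delta>" and "g \<in> U" "h \<in> U"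
    and "norm (\<xi> g) < \<delta>" "norm (\<xi> h) < \<delta>"
  shows "norm (\<xi> (g \<otimes> h) - \<xi> g - \<xi> h) \<le> \<epsilon> * norm (\<xi> h)"
    and "norm (\<xi> (g \<otimes> h) - \<xi> g - \<xi> h) \<le> \<epsilon> * norm (\<xi> g)"
proof -
  have d: "0 < \<delta>" using assms(4) by (meson norm_ge_zero order_le_less_trans)
  show "norm (\<xi> (g \<otimes> h) - \<xi> g - \<xi> h) \<le> \<epsilon> * norm (\<xi> h)"
    using mult_lipschitz_right[OF s, of g h \<one>] assms d by (simp add: one_in coord_one)
  show "norm (\<xi> (g \<otimes> h) - \<xi> g - \<xi> h) \<le> \<epsilon> * norm (\<xi> g)"
    using mult_lipschitz_left[OF s, of g \<one> h] assms d
    by (simp add: one_in coord_one algebra_simps)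
qed

text \<open>By induction: each further factor \<open>a\<close> adds \<open>\<xi> a\<close> up to an error of \<open>\<epsilon> * norm (\<xi> a)\<close>. The powers
  stay in the range of the approximation because \<open>\<epsilon> \<le> 1\<close> keeps them below twice their expected
  size.\<close>

lemma pow_estimate:
  assumes s: "strict_approx \<xi> (\<otimes>) U \<epsilon> \<delta>" and "0 < \<delta>" "\<epsilon> \<le> 1" "a \<in> U"
    and "2 * real k * norm (\<xi> a) < \<delta>"
  shows "a [^] k \<in> U \<and> norm (\<xi> (a [^] k) - real k *\<^sub>R \<xi> a) \<le> \<epsilon> * (real k * norm (\<xi> a))"
  using assms(5)
proof (induction k)
  case 0
  then show ?case by (simp add: one_in coord_one)
next
  case (Suc k)
  have le: "2 * real k * norm (\<xi> a) \<le> 2 * real (Suc k) * norm (\<xi> a)"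
    by (intro mult_right_mono) auto
  have IH: "a [^] k \<in> U" "norm (\<xi> (a [^] k) - real k *\<^sub>R \<xi> a) \<le> \<epsilon> * (real k * norm (\<xi> a))"
    using Suc le by auto
  have a: "norm (\<xi> a) < \<delta>"
  proof -
    have "norm (\<xi> a) \<le> 2 * real (Suc k) * norm (\<xi> a)"
      using mult_right_mono[of 1 "2 * real (Suc k)" "norm (\<xi> a)"] by simp
    with Suc.prems show ?thesis by linarith
  qed
  have "\<epsilon> * (real k * norm (\<xi> a)) \<le> 1 * (real k * norm (\<xi> a))"
    by (rule mult_right_mono) (use assms in auto)
  moreover have "norm (\<xi> (a [^] k)) \<le> norm (\<xi> (a [^] k) - real k *\<^sub>R \<xi> a) + norm (real k *\<^sub>R \<xi> a)"
    by (metis add.commute norm_triangle_sub)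
  ultimately have "norm (\<xi> (a [^] k)) \<le> 2 * real k * norm (\<xi> a)"
    using IH by simp
  then have k: "norm (\<xi> (a [^] k)) < \<delta>" using le Suc.prems by linarith
  have U: "a [^] Suc k \<in> U"
    using mult_in_U[OF s IH(1) assms(4) k a] by simp
  have "norm (\<xi> (a [^] Suc k) - \<xi> (a [^] k) - \<xi> a) \<le> \<epsilon> * norm (\<xi> a)"
    using mult_almost_add(1)[OF s IH(1) assms(4) k a] by simp
  moreover have "\<xi> (a [^] Suc k) - real (Suc k) *\<^sub>R \<xi> a
      = (\<xi> (a [^] Suc k) - \<xi> (a [^] k) - \<xi> a) + (\<xi> (a [^] k) - real k *\<^sub>R \<xi> a)"
    by (simp add: algebra_simps)
  ultimately have "norm (\<xi> (a [^] Suc k) - real (Suc k) *\<^sub>R \<xi> a)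
      \<le> \<epsilon> * norm (\<xi> a) + \<epsilon> * (real k * norm (\<xi> a))"
    using IH(2) norm_triangle_mono by metis
  then show ?case using U by (simp add: algebra_simps)
qed

lemma pow_bound:
  assumes s: "strict_approx \<xi> (\<otimes>) U 1 \<delta>" and "0 < \<delta>" "a \<in> U"
    and "2 * real k * norm (\<xi> a) < \<delta>"
  shows "a [^] k \<in> U" "norm (\<xi> (a [^] k)) \<le> 2 * real k * norm (\<xi> a)"
proof -
  have *: "a [^] k \<in> U \<and> norm (\<xi> (a [^] k) - real k *\<^sub>R \<xi> a) \<le> 1 * (real k * norm (\<xi> a))"
    using pow_estimate[OF s assms(2) _ assms(3,4)] by simp
  then show "a [^] k \<in> U" by simp
  have "norm (\<xi> (a [^] k)) \<le> norm (\<xi> (a [^] k) - real k *\<^sub>R \<xi> a) + norm (real k *\<^sub>R \<xi> a)"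
    by (metis add.commute norm_triangle_sub)
  then show "norm (\<xi> (a [^] k)) \<le> 2 * real k * norm (\<xi> a)" using * by simp
qed

text \<open>Change \<open>b\<^sup>k\<close> into \<open>a\<^sup>k\<close> through the products \<open>a\<^sup>i b\<^bsup>k-i\<^esup>\<close>, one factor at a time. A change
  of one factor is amplified by at most 2 in each of the multiplications by \<open>b\<^bsup>k-i-1\<^esup>\<close> on the right
  and by \<open>a\<^sup>i\<close> on the left, hence the factor 4. The constant 16 keeps all the intermediate products
  in the range of the approximation.\<close>

lemma pow_stability:
  assumes s: "strict_approx \<xi> (\<otimes>) U 1 \<delta>" and \<delta>: "0 < \<delta>" and a: "a \<in> U" and b: "b \<in> U"
    and ka: "16 * (real k * norm (\<xi> a)) < \<delta>" and kb: "16 * (real k * norm (\<xi> b)) < \<delta>"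
  shows "norm (\<xi> (a [^] k) - \<xi> (b [^] k)) \<le> 4 * real k * norm (\<xi> a - \<xi> b)"
proof -
  have small: "c [^] j \<in> U \<and> norm (\<xi> (c [^] j)) < \<delta> / 4"
    if "j \<le> k" "c \<in> U" "16 * (real k * norm (\<xi> c)) < \<delta>" for c j
  proof -
    have "real j * norm (\<xi> c) \<le> real k * norm (\<xi> c)"
      by (rule mult_right_mono) (use that in auto)
    then have "8 * (2 * real j * norm (\<xi> c)) < \<delta>" using that by simp
    moreover have "0 \<le> 2 * real j * norm (\<xi> c)" by simp
    ultimately show ?thesis using pow_bound[OF s \<delta> that(2), of j] by linarith
  qed
  have "a [^] i \<otimes> b [^] (k - i) \<in> U \<and>
      norm (\<xi> (a [^] i \<otimes> b [^] (k - i)) - \<xi> (b [^] k)) \<le> 4 * real i * norm (\<xi> a - \<xi> b)"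
    if "i \<le> k" for i
    using that
  proof (induction i)
    case 0
    have "b [^] k \<in> U" using small[of k b] b kb by simp
    then show ?case using in_carrier by simp
  next
    case (Suc i)
    let ?u = "a [^] i" and ?v = "b [^] (k - Suc i)"
    have k1: "1 \<le> k" using Suc by simp
    have u: "?u \<in> U" "norm (\<xi> ?u) < \<delta> / 4" using small[of i a] a ka Suc by auto
    have v: "?v \<in> U" "norm (\<xi> ?v) < \<delta> / 4" using small[of "k - Suc i" b] b kb by auto
    have a4: "norm (\<xi> a) < \<delta> / 4" using small[of 1 a] a ka k1 by simp
    have b4: "norm (\<xi> b) < \<delta> / 4" using small[of 1 b] b kb k1 by simp
    have av: "c \<otimes> ?v \<in> U" "norm (\<xi> (c \<otimes> ?v)) < \<delta>"
      if c: "c \<in> U" "norm (\<xi> c) < \<delta> / 4" for c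
    proof -
      show "c \<otimes> ?v \<in> U" using mult_in_U[OF s c(1) v(1)] c v \<delta> by linarith
      have "norm (\<xi> (c \<otimes> ?v) - \<xi> c - \<xi> ?v) \<le> 1 * norm (\<xi> ?v)"
        using mult_almost_add(1)[OF s c(1) v(1)] c v \<delta> by linarith
      then have "norm (\<xi> (c \<otimes> ?v)) \<le> norm (\<xi> c) + norm (\<xi> ?v) + norm (\<xi> ?v)"
        by norm
      then show "norm (\<xi> (c \<otimes> ?v)) < \<delta>" using c v \<delta> by linarith
    qed
    have "norm (\<xi> (a \<otimes> ?v) - \<xi> (b \<otimes> ?v) - (\<xi> a - \<xi> b)) \<le> 1 * norm (\<xi> a - \<xi> b)"
      using mult_lipschitz_left[OF s a b v(1)] a4 b4 v \<delta> by linarith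
    then have 1: "norm (\<xi> (a \<otimes> ?v) - \<xi> (b \<otimes> ?v)) \<le> 2 * norm (\<xi> a - \<xi> b)" by norm
    have "norm (\<xi> (?u \<otimes> (a \<otimes> ?v)) - \<xi> (?u \<otimes> (b \<otimes> ?v)) - (\<xi> (a \<otimes> ?v) - \<xi> (b \<otimes> ?v)))
        \<le> 1 * norm (\<xi> (a \<otimes> ?v) - \<xi> (b \<otimes> ?v))"
      using mult_lipschitz_right[OF s u(1) av(1)[OF a a4] av(1)[OF b b4]]
        av(2)[OF a a4] av(2)[OF b b4] u \<delta> by linarith
    then have 2: "norm (\<xi> (?u \<otimes> (a \<otimes> ?v)) - \<xi> (?u \<otimes> (b \<otimes> ?v))) \<le> 4 * norm (\<xi> a - \<xi> b)"
      using 1 by norm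
    have e1: "a [^] Suc i \<otimes> ?v = ?u \<otimes> (a \<otimes> ?v)"
      using a b by (simp add: m_assoc)
    have "b [^] (k - i) = b [^] Suc (k - Suc i)" using Suc by (simp add: Suc_diff_Suc)
    also have "\<dots> = b \<otimes> ?v" using b by (metis in_carrier nat_pow_Suc2)
    finally have e2: "a [^] i \<otimes> b [^] (k - i) = ?u \<otimes> (b \<otimes> ?v)" by simp
    have "?u \<otimes> (a \<otimes> ?v) \<in> U"
      using mult_in_U[OF s u(1) av(1)[OF a a4]] av(2)[OF a a4] u \<delta> by linarith
    moreover have "norm (\<xi> (?u \<otimes> (a \<otimes> ?v)) - \<xi> (b [^] k)) \<le> 4 * real (Suc i) * norm (\<xi> a - \<xi> b)"
    proof -
      have "norm (\<xi> (?u \<otimes> (b \<otimes> ?v)) - \<xi> (b [^] k)) \<le> 4 * real i * norm (\<xi> a - \<xi> b)"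
        using Suc e2 by simp
      then have "norm (\<xi> (?u \<otimes> (a \<otimes> ?v)) - \<xi> (b [^] k))
        \<le> 4 * norm (\<xi> a - \<xi> b) + 4 * real i * norm (\<xi> a - \<xi> b)"
        using 2 by norm
      then show ?thesis by (simp add: algebra_simps)
    qed
    ultimately show ?case using e1 by simp
  qed
  from this[of k] show ?thesis using a b by simp
qed

end

section \<open>The exponential map near the identity\<close>

context coordinate_group begin

text \<open>A scale on which the coordinates are surjective and the multiplication deviates from the addition
  by a 1-Lipschitz map. The exponential map is first constructed for vectors below \<open>radius / 64\<close>, which
  leaves room for the factor 16 in \<open>pow_stability\<close> and the factor 2 in \<open>pow_bound\<close>.\<close>

definition radius :: real
  where "radius = (SOME r. r > 0 \<and> ball 0 r \<subseteq> \<xi> ` U \<and> strict_approx \<xi> (\<otimes>) U 1 r)"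

lemma radius_props: "radius > 0 \<and> ball 0 radius \<subseteq> \<xi> ` U \<and> strict_approx \<xi> (\<otimes>) U 1 radius"
proof -
  obtain r where r: "r > 0" "ball 0 r \<subseteq> \<xi> ` U" using coord_surj by blast
  obtain d where d: "d > 0" "strict_approx \<xi> (\<otimes>) U 1 d" using strict[of 1] by auto
  have "min r d > 0 \<and> ball 0 (min r d) \<subseteq> \<xi> ` U \<and> strict_approx \<xi> (\<otimes>) U 1 (min r d)"
    using r d strict_approx_mono[OF d(2), of "min r d"] by auto
  then show ?thesis unfolding radius_def by (rule someI)
qed

lemmas radius_pos = radius_props[THEN conjunct1]
lemmas strict_radius = radius_props[THEN conjunct2, THEN conjunct2]

definition point :: "'e \<Rightarrow> 'a" where "point x = inv_into U \<xi> x"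

lemma point_props:
  assumes "norm x < radius"
  shows "point x \<in> U" "\<xi> (point x) = x"
proof -
  have "x \<in> \<xi> ` U" using assms radius_props by auto
  then show "point x \<in> U" "\<xi> (point x) = x"
    unfolding point_def by (auto intro: inv_into_into f_inv_into_f)
qed

text \<open>The element that is to approximate the \<open>n\<close>-th root of the exponential of \<open>v\<close>.\<close>

definition euler :: "'e \<Rightarrow> nat \<Rightarrow> 'a" where "euler v n = point (v /\<^sub>R real n)"

lemma norm_div_le: "norm (v /\<^sub>R real n) \<le> norm (v :: 'e)"
proof (cases "n = 0")
  case False
  then have "inverse (real n) \<le> 1" by (simp add: inverse_le_1_iff)
  then show ?thesis using mult_right_mono[of "inverse (real n)" 1 "norm v"] by simp
qed auto

lemma div_nat_limit: "(\<lambda>n. (v :: 'e) /\<^sub>R real n) \<longlonglongrightarrow> 0"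
  using tendsto_scaleR[OF lim_inverse_n tendsto_const[of v]] by simp

lemma euler_props:
  assumes "norm v < radius / 64"
  shows "euler v n \<in> U" "\<xi> (euler v n) = v /\<^sub>R real n"
proof -
  have "norm (v /\<^sub>R real n) < radius"
    using norm_div_le[of n v] assms radius_pos by linarith
  then show "euler v n \<in> U" "\<xi> (euler v n) = v /\<^sub>R real n"
    unfolding euler_def by (rule point_props)+
qed

text \<open>The \<open>m\<close>-th power of the finer root has coordinates \<open>v / n\<close> up to \<open>\<epsilon> * norm v / n\<close>. By
  stability, \<open>n\<close> such steps multiply the error by \<open>4 * n\<close>.\<close>

lemma euler_refine:
  assumes s: "strict_approx \<xi> (\<otimes>) U \<epsilon> \<delta>" and \<delta>: "\<delta> > 0" and \<epsilon>: "\<epsilon> \<le> 1"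
    and v: "norm v < radius / 64" and n: "n > 0" "2 * norm v < real n * \<delta>" and m: "m > 0"
  shows "norm (\<xi> (euler v (n * m) [^] (n * m)) - \<xi> (euler v n [^] n)) \<le> 4 * (\<epsilon> * norm v)"
proof -
  let ?e = "euler v (n * m)"
  let ?c = "?e [^] m"
  note e = euler_props[OF v, of "n * m"] and e' = euler_props[OF v, of n]
  have me: "real m * norm (\<xi> ?e) = norm v / real n" using e(2) m n by (simp add: field_simps)
  have "2 * (norm v / real n) < \<delta>" using n by (simp add: field_simps)
  then have "2 * real m * norm (\<xi> ?e) < \<delta>" using me by linarith
  then have c: "?c \<in> U" "norm (\<xi> ?c - real m *\<^sub>R \<xi> ?e) \<le> \<epsilon> * (real m * norm (\<xi> ?e))"
    using pow_estimate[OF s \<delta> \<epsilon> e(1)] by auto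
  have eq: "real m *\<^sub>R \<xi> ?e = \<xi> (euler v n)" using e(2) e'(2) m n by (simp add: field_simps)
  have vn: "norm v / real n \<le> norm v" using norm_div_le[of n v] by (simp add: divide_inverse mult.commute)
  have "2 * real m * norm (\<xi> ?e) < radius" using me vn v radius_pos by (simp add: mult.assoc)
  then have "norm (\<xi> ?c) \<le> 2 * real m * norm (\<xi> ?e)"
    using pow_bound[OF strict_radius radius_pos e(1)] by auto
  then have "norm (\<xi> ?c) \<le> 2 * (norm v / real n)" using me by simp
  then have cn: "real n * norm (\<xi> ?c) \<le> 2 * norm v" using n by (simp add: field_simps)
  have en: "real n * norm (\<xi> (euler v n)) = norm v" using e'(2) n by simp
  have "norm (\<xi> (?c [^] n) - \<xi> (euler v n [^] n)) \<le> 4 * real n * norm (\<xi> ?c - \<xi> (euler v n))"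
    by (rule pow_stability[OF strict_radius radius_pos c(1) e'(1)])
       (use cn en v radius_pos norm_ge_zero[of v] in linarith)+
  also have "\<dots> \<le> 4 * real n * (\<epsilon> * (norm v / real n))"
    using c(2) unfolding eq me by (intro mult_left_mono) auto
  also have "\<dots> = 4 * (\<epsilon> * norm v)" using n by simp
  finally show ?thesis using e(1) by (simp add: nat_pow_pow mult.commute)
qed

definition local_exp :: "'e \<Rightarrow> 'a"
  where "local_exp v = point (lim (\<lambda>n. \<xi> (euler v n [^] n)))"

lemma euler_power_bound:
  assumes v: "norm v < radius / 64"
  shows "euler v n [^] n \<in> U" "norm (\<xi> (euler v n [^] n)) \<le> 2 * norm v"
proof -
  note e = euler_props[OF v, of n]
  have le: "real n * norm (\<xi> (euler v n)) \<le> norm v"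
    using e(2) by (cases "n = 0") (auto simp: field_simps)
  then have "2 * real n * norm (\<xi> (euler v n)) < radius" using v radius_pos by linarith
  from pow_bound[OF strict_radius radius_pos e(1) this] le
  show "euler v n [^] n \<in> U" "norm (\<xi> (euler v n [^] n)) \<le> 2 * norm v" by linarith+
qed

text \<open>Both terms of index \<open>n\<close> and \<open>m\<close> are compared with the term of index \<open>n * m\<close>.\<close>

lemma euler_powers_Cauchy:
  assumes v: "norm v < radius / 64"
  shows "Cauchy (\<lambda>n. \<xi> (euler v n [^] n))"
proof (rule metric_CauchyI)
  fix e :: real assume e: "e > 0"
  \<comment> \<open>The summand \<open>1\<close> only avoids a division by zero for \<open>v = 0\<close>.\<close>
  define K where "K = norm v + 1"
  have K: "norm v \<le> K" "K > 0" by (auto simp: K_def intro!: add_nonneg_pos)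
  define \<epsilon> where "\<epsilon> = min 1 (e / (16 * K))"
  have \<epsilon>: "\<epsilon> > 0" "\<epsilon> \<le> 1" using e K by (auto simp: \<epsilon>_def)
  have "\<epsilon> * norm v \<le> e / (16 * K) * K"
    by (rule mult_mono) (use e K in \<open>auto simp: \<epsilon>_def\<close>)
  also have "\<dots> = e / 16" using K by simp
  finally have \<epsilon>v: "8 * (\<epsilon> * norm v) < e" using e by simp
  obtain \<delta> where \<delta>: "\<delta> > 0" "strict_approx \<xi> (\<otimes>) U \<epsilon> \<delta>" using strict[OF \<epsilon>(1)] by blast
  obtain M where M: "2 * norm v < real M * \<delta>"
    using reals_Archimedean3[OF \<delta>(1)] by blast
  show "\<exists>M. \<forall>m\<ge>M. \<forall>n\<ge>M. dist (\<xi> (euler v m [^] m)) (\<xi> (euler v n [^] n)) < e"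
  proof (intro exI allI impI)
    fix m n assume mn: "m \<ge> Suc M" "n \<ge> Suc M"
    have big: "2 * norm v < real k * \<delta>" if "k \<ge> Suc M" for k
    proof -
      have "real M * \<delta> \<le> real k * \<delta>" using that \<delta> by (intro mult_right_mono) auto
      then show ?thesis using M by linarith
    qed
    have 1: "norm (\<xi> (euler v (n * m) [^] (n * m)) - \<xi> (euler v n [^] n)) \<le> 4 * (\<epsilon> * norm v)"
      using euler_refine[OF \<delta>(2,1) \<epsilon>(2) v _ big[OF mn(2)], of m] mn by simp
    have 2: "norm (\<xi> (euler v (m * n) [^] (m * n)) - \<xi> (euler v m [^] m)) \<le> 4 * (\<epsilon> * norm v)"
      using euler_refine[OF \<delta>(2,1) \<epsilon>(2) v _ big[OF mn(1)], of n] mn by simp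
    have "norm (\<xi> (euler v m [^] m) - \<xi> (euler v n [^] n)) \<le> 4 * (\<epsilon> * norm v) + 4 * (\<epsilon> * norm v)"
      using 1 2 by (simp add: mult.commute[of m n]) norm
    then show "dist (\<xi> (euler v m [^] m)) (\<xi> (euler v n [^] n)) < e"
      using \<epsilon>v by (simp add: dist_norm)
  qed
qed

lemma local_exp_limit:
  assumes v: "norm v < radius / 64"
  shows "local_exp v \<in> U" "(\<lambda>n. \<xi> (euler v n [^] n)) \<longlonglongrightarrow> \<xi> (local_exp v)"
    "norm (\<xi> (local_exp v)) \<le> 2 * norm v"
proof -
  let ?s = "\<lambda>n. \<xi> (euler v n [^] n)"
  have lim: "?s \<longlonglongrightarrow> lim ?s"
    by (rule convergent_LIMSEQ_iff[THEN iffD1, OF Cauchy_convergent[OF euler_powers_Cauchy[OF v]]])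
  have le: "norm (lim ?s) \<le> 2 * norm v"
    by (rule LIMSEQ_le_const2[OF tendsto_norm[OF lim]]) (use euler_power_bound[OF v] in auto)
  then have "norm (lim ?s) < radius" using v radius_pos norm_ge_zero[of v] by linarith
  note p = point_props[OF this]
  show "local_exp v \<in> U" unfolding local_exp_def by (rule p)
  show "?s \<longlonglongrightarrow> \<xi> (local_exp v)" unfolding local_exp_def p(2) by (rule lim)
  show "norm (\<xi> (local_exp v)) \<le> 2 * norm v" unfolding local_exp_def p(2) by (rule le)
qed

lemma local_exp_in_carrier [simp, intro]: "norm v < radius / 64 \<Longrightarrow> local_exp v \<in> carrier G"
  using local_exp_limit(1) by blast

lemma local_exp_almost_id:
  assumes s: "strict_approx \<xi> (\<otimes>) U \<epsilon> \<delta>" "\<delta> > 0" "\<epsilon> \<le> 1"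
    and v: "norm v < radius / 64" "2 * norm v < \<delta>"
  shows "norm (\<xi> (local_exp v) - v) \<le> \<epsilon> * norm v"
proof (rule LIMSEQ_le_const2)
  show "(\<lambda>n. norm (\<xi> (euler v n [^] n) - v)) \<longlonglongrightarrow> norm (\<xi> (local_exp v) - v)"
    by (intro tendsto_intros local_exp_limit v)
  have "norm (\<xi> (euler v n [^] n) - v) \<le> \<epsilon> * norm v" if "n \<ge> 1" for n
  proof -
    note e = euler_props[OF v(1), of n]
    have "real n * norm (\<xi> (euler v n)) = norm v" "real n *\<^sub>R \<xi> (euler v n) = v"
      using e(2) that by auto
    then show ?thesis using pow_estimate[OF s e(1), of n] v(2) by (simp add: mult.assoc)
  qed
  then show "\<exists>N. \<forall>n\<ge>N. norm (\<xi> (euler v n [^] n) - v) \<le> \<epsilon> * norm v" by blast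
qed

text \<open>By stability, the power \<open>a\<^sub>n\<^sup>n\<close> differs from that of the root with coordinates \<open>v / n\<close> by at most
  four times \<open>norm (n *\<^sub>R \<xi> (a n) - v)\<close>. Inverses, sums and the uniqueness of one-parameter
  subgroups are treated by suitable choices of \<open>a\<close>.\<close>

lemma pow_limit:
  assumes v: "norm v < radius / 64" and a: "\<forall>\<^sub>F n in sequentially. a n \<in> U"
    and lim: "(\<lambda>n. real n *\<^sub>R \<xi> (a n)) \<longlonglongrightarrow> v"
  shows "\<forall>\<^sub>F n in sequentially. a n [^] n \<in> U"
    and "(\<lambda>n. \<xi> (a n [^] n)) \<longlonglongrightarrow> \<xi> (local_exp v)"
proof -
  have "\<forall>\<^sub>F n in sequentially. norm (real n *\<^sub>R \<xi> (a n)) < radius / 64"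
    by (rule order_tendstoD(2)[OF tendsto_norm[OF lim] v])
  then have small: "\<forall>\<^sub>F n in sequentially. real n * norm (\<xi> (a n)) < radius / 64"
    by eventually_elim simp
  show "\<forall>\<^sub>F n in sequentially. a n [^] n \<in> U"
    using a small
    by eventually_elim (rule pow_bound(1)[OF strict_radius radius_pos], use radius_pos in auto)
  have "\<forall>\<^sub>F n in sequentially. norm (\<xi> (a n [^] n) - \<xi> (euler v n [^] n))
      \<le> 4 * norm (real n *\<^sub>R \<xi> (a n) - v)"
    using a small eventually_gt_at_top[of 0]
  proof eventually_elim
    case (elim n)
    note e = euler_props[OF v, of n]
    have "real n * norm (\<xi> (euler v n)) = norm v" using e(2) elim by simp
    then have "norm (\<xi> (a n [^] n) - \<xi> (euler v n [^] n)) \<le> 4 * real n * norm (\<xi> (a n) - \<xi> (euler v n))"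
      by (intro pow_stability[OF strict_radius radius_pos elim(1) e(1)]) (use elim v radius_pos in linarith)+
    also have "\<dots> = 4 * norm (real n *\<^sub>R (\<xi> (a n) - \<xi> (euler v n)))" by simp
    also have "real n *\<^sub>R (\<xi> (a n) - \<xi> (euler v n)) = real n *\<^sub>R \<xi> (a n) - v"
      using e(2) elim by (simp add: algebra_simps)
    finally show ?case .
  qed
  moreover have "(\<lambda>n. 4 * norm (real n *\<^sub>R \<xi> (a n) - v)) \<longlonglongrightarrow> 0"
    using lim by (auto intro!: tendsto_mult_right_zero tendsto_norm_zero simp: LIM_zero)
  ultimately have "(\<lambda>n. \<xi> (a n [^] n) - \<xi> (euler v n [^] n)) \<longlonglongrightarrow> 0"
    by (rule Lim_null_comparison)
  from tendsto_add[OF this local_exp_limit(2)[OF v]]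
  show "(\<lambda>n. \<xi> (a n [^] n)) \<longlonglongrightarrow> \<xi> (local_exp v)" by simp
qed

lemma mult_limit:
  assumes "\<forall>\<^sub>F n in sequentially. a n \<in> U" "\<forall>\<^sub>F n in sequentially. b n \<in> U"
    and lim: "(\<lambda>n. \<xi> (a n)) \<longlonglongrightarrow> \<xi> g" "(\<lambda>n. \<xi> (b n)) \<longlonglongrightarrow> \<xi> h"
    and gh: "g \<in> U" "h \<in> U" "norm (\<xi> g) < radius" "norm (\<xi> h) < radius"
  shows "(\<lambda>n. \<xi> (a n \<otimes> b n)) \<longlonglongrightarrow> \<xi> (g \<otimes> h)"
proof -
  have "\<forall>\<^sub>F n in sequentially. norm (\<xi> (a n)) < radius" "\<forall>\<^sub>F n in sequentially. norm (\<xi> (b n)) < radius"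
    by (rule order_tendstoD(2)[OF tendsto_norm[OF lim(1)] gh(3)]
        order_tendstoD(2)[OF tendsto_norm[OF lim(2)] gh(4)])+
  with assms(1,2) have "\<forall>\<^sub>F n in sequentially. norm (\<xi> (a n \<otimes> b n) - \<xi> (g \<otimes> h))
      \<le> 2 * (norm (\<xi> (a n) - \<xi> g) + norm (\<xi> (b n) - \<xi> h))"
  proof eventually_elim
    case (elim n)
    have "norm (\<xi> (a n \<otimes> b n) - \<xi> (g \<otimes> h) - (\<xi> (a n) - \<xi> g) - (\<xi> (b n) - \<xi> h))
        \<le> 1 * (norm (\<xi> (a n) - \<xi> g) + norm (\<xi> (b n) - \<xi> h))"
      using strict_approxD(2)[OF strict_radius elim(1,2) gh(1,2) elim(3,4) gh(3,4)] .
    then show ?case by norm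
  qed
  moreover have "(\<lambda>n. 2 * (norm (\<xi> (a n) - \<xi> g) + norm (\<xi> (b n) - \<xi> h))) \<longlonglongrightarrow> 0"
    using lim by (auto intro!: tendsto_mult_right_zero tendsto_add_zero tendsto_norm_zero simp: LIM_zero)
  ultimately have "(\<lambda>n. \<xi> (a n \<otimes> b n) - \<xi> (g \<otimes> h)) \<longlonglongrightarrow> 0"
    by (rule Lim_null_comparison)
  then show ?thesis by (simp add: LIM_zero_iff)
qed

lemma local_exp_lipschitz:
  assumes v: "norm v < radius / 64" and w: "norm w < radius / 64"
  shows "norm (\<xi> (local_exp v) - \<xi> (local_exp w)) \<le> 4 * norm (v - w)"
proof (rule LIMSEQ_le_const2)
  show "(\<lambda>n. norm (\<xi> (euler v n [^] n) - \<xi> (euler w n [^] n)))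
      \<longlonglongrightarrow> norm (\<xi> (local_exp v) - \<xi> (local_exp w))"
    by (intro tendsto_intros local_exp_limit v w)
  have "norm (\<xi> (euler v n [^] n) - \<xi> (euler w n [^] n)) \<le> 4 * norm (v - w)" if "n \<ge> 1" for n
  proof -
    note e = euler_props[OF v, of n] and f = euler_props[OF w, of n]
    have "real n * norm (\<xi> (euler v n)) = norm v" "real n * norm (\<xi> (euler w n)) = norm w"
      using e(2) f(2) that by auto
    then have "norm (\<xi> (euler v n [^] n) - \<xi> (euler w n [^] n))
        \<le> 4 * real n * norm (\<xi> (euler v n) - \<xi> (euler w n))"
      by (intro pow_stability[OF strict_radius radius_pos e(1) f(1)]) (use v w radius_pos in linarith)+
    also have "\<dots> = 4 * norm (real n *\<^sub>R (\<xi> (euler v n) - \<xi> (euler w n)))" by simp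
    also have "real n *\<^sub>R (\<xi> (euler v n) - \<xi> (euler w n)) = v - w"
      using e(2) f(2) that by (simp add: algebra_simps)
    finally show ?thesis .
  qed
  then show "\<exists>N. \<forall>n\<ge>N. norm (\<xi> (euler v n [^] n) - \<xi> (euler w n [^] n)) \<le> 4 * norm (v - w)"
    by blast
qed

lemma local_exp_zero: "local_exp 0 = \<one>"
  using local_exp_limit[of 0] radius_pos coord_eqD[OF _ one_in] coord_one by auto

text \<open>The \<open>n * k\<close>-th root that belongs to \<open>k v\<close> is the \<open>n\<close>-th root that belongs to \<open>v\<close>, so the approximations
  to the left-hand side have a subsequence of \<open>k\<close>-th powers of approximations to \<open>local_exp v\<close>.\<close>

lemma local_exp_pow:
  assumes kv: "norm (real k *\<^sub>R v) < radius / 64" and k: "k > 0"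
  shows "local_exp (real k *\<^sub>R v) = local_exp v [^] k"
proof -
  have kv': "real k * norm v < radius / 64" using kv by simp
  have "1 * norm v \<le> real k * norm v" by (rule mult_right_mono) (use k in auto)
  then have v: "norm v < radius / 64" using kv' by linarith
  note E = local_exp_limit[OF v]
  have "real k * norm (\<xi> (local_exp v)) \<le> real k * (2 * norm v)"
    by (rule mult_left_mono) (use E in auto)
  then have kE: "16 * (real k * norm (\<xi> (local_exp v))) < radius" using kv' radius_pos by linarith
  have inU: "local_exp v [^] k \<in> U"
    by (rule pow_bound(1)[OF strict_radius radius_pos E(1)]) (use kE in \<open>auto simp: mult.assoc\<close>,
       use kE radius_pos in linarith)
  have "\<xi> (euler v n [^] (n * k)) = \<xi> ((euler v n [^] n) [^] k)" for n
    using euler_props(1)[OF v] by (simp add: nat_pow_pow)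
  have est: "norm (\<xi> ((euler v n [^] n) [^] k) - \<xi> (local_exp v [^] k))
      \<le> 4 * real k * norm (\<xi> (euler v n [^] n) - \<xi> (local_exp v))" for n
  proof (rule pow_stability[OF strict_radius radius_pos euler_power_bound(1)[OF v] E(1) _ kE])
    have "real k * norm (\<xi> (euler v n [^] n)) \<le> real k * (2 * norm v)"
      by (rule mult_left_mono) (use euler_power_bound[OF v] in auto)
    then show "16 * (real k * norm (\<xi> (euler v n [^] n))) < radius" using kv' radius_pos by linarith
  qed
  have "(\<lambda>n. 4 * real k * norm (\<xi> (euler v n [^] n) - \<xi> (local_exp v))) \<longlonglongrightarrow> 0"
    using E(2) by (auto intro!: tendsto_mult_right_zero tendsto_norm_zero simp: LIM_zero)
  then have "(\<lambda>n. \<xi> ((euler v n [^] n) [^] k) - \<xi> (local_exp v [^] k)) \<longlonglongrightarrow> 0"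
    by (rule Lim_null_comparison[rotated]) (use est in auto)
  then have 1: "(\<lambda>n. \<xi> ((euler v n [^] n) [^] k)) \<longlonglongrightarrow> \<xi> (local_exp v [^] k)"
    by (simp add: LIM_zero_iff)
  have eq: "(euler v n [^] n) [^] k = euler (real k *\<^sub>R v) (n * k) [^] (n * k)" for n
  proof -
    have "(real k *\<^sub>R v) /\<^sub>R real (n * k) = v /\<^sub>R real n" using k by (simp add: field_simps)
    then have "euler (real k *\<^sub>R v) (n * k) = euler v n" unfolding euler_def by (rule arg_cong)
    then show ?thesis using euler_props(1)[OF v] by (simp add: nat_pow_pow)
  qed
  have "strict_mono (\<lambda>n. n * k)" using k by (simp add: strict_mono_def)
  from LIMSEQ_subseq_LIMSEQ[OF local_exp_limit(2)[OF kv] this]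
  have "(\<lambda>n. \<xi> ((euler v n [^] n) [^] k)) \<longlonglongrightarrow> \<xi> (local_exp (real k *\<^sub>R v))"
    unfolding eq by (simp add: o_def)
  with 1 have "\<xi> (local_exp (real k *\<^sub>R v)) = \<xi> (local_exp v [^] k)"
    using LIMSEQ_unique by blast
  then show ?thesis by (rule coord_eqD[OF local_exp_limit(1)[OF kv] inU])
qed

text \<open>The estimate for the product of \<open>g\<close> and its inverse, whose coordinates are \<open>0\<close>; continuity of
  the inverse ensures that it is applicable.\<close>

lemma inverse_almost_minus:
  assumes s: "strict_approx \<xi> (\<otimes>) U \<epsilon> \<delta>" and "\<delta> > 0"
  obtains \<delta>' where "\<delta>' > 0"
    "\<And>g. g \<in> U \<Longrightarrow> norm (\<xi> g) < \<delta>' \<Longrightarrow>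
      inv g \<in> U \<and> norm (\<xi> (inv g)) < \<delta> \<and> norm (\<xi> (inv g) + \<xi> g) \<le> \<epsilon> * norm (\<xi> g)"
proof -
  let ?W = "{g \<in> topspace T. inv g \<in> {g \<in> U. norm (\<xi> g) < \<delta>}}"
  have "openin T ?W"
    by (rule openin_continuous_map_preimage[OF inv_continuous open_coord_ball[OF \<open>\<delta> > 0\<close>]])
  moreover have "\<one> \<in> ?W" using assms one_in coord_one by (simp add: topspace_carrier)
  ultimately obtain d where d: "d > 0" "{g \<in> U. norm (\<xi> g) < d} \<subseteq> ?W"
    using coord_ball_nbhd by blast
  show thesis
  proof (rule that[of "min d \<delta>"])
    fix g assume g: "g \<in> U" "norm (\<xi> g) < min d \<delta>"
    then have i: "inv g \<in> U" "norm (\<xi> (inv g)) < \<delta>" using d by auto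
    have "norm (\<xi> (g \<otimes> inv g) - \<xi> g - \<xi> (inv g)) \<le> \<epsilon> * norm (\<xi> g)"
      using mult_almost_add(2)[OF s g(1) i(1) _ i(2)] g by simp
    moreover have "\<xi> (g \<otimes> inv g) = 0" using g coord_one by simp
    ultimately have "norm (- (\<xi> (inv g) + \<xi> g)) \<le> \<epsilon> * norm (\<xi> g)" by (simp add: algebra_simps)
    then show "inv g \<in> U \<and> norm (\<xi> (inv g)) < \<delta> \<and> norm (\<xi> (inv g) + \<xi> g) \<le> \<epsilon> * norm (\<xi> g)"
      using i by (simp add: norm_minus_cancel del: minus_add_distrib)
  qed (use d assms in auto)
qed

text \<open>The inverses of the roots that belong to \<open>v\<close> agree with the roots that belong to \<open>- v\<close> to first
  order.\<close>

lemma local_exp_minus: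
  assumes v: "norm v < radius / 64"
  shows "local_exp (- v) = inv (local_exp v)"
proof -
  let ?a = "\<lambda>n. inv (euler v n)"
  have v': "norm (- v) < radius / 64" using v by simp
  have ev: "\<forall>\<^sub>F n in sequentially. ?a n \<in> U \<and> norm (real n *\<^sub>R \<xi> (?a n) - (- v)) \<le> \<epsilon> * norm v"
    if \<epsilon>: "\<epsilon> > 0" for \<epsilon>
  proof -
    obtain \<delta> where "\<delta> > 0" "strict_approx \<xi> (\<otimes>) U \<epsilon> \<delta>" using strict[OF \<epsilon>] by blast
    then obtain d where d: "d > 0" "\<And>g. g \<in> U \<Longrightarrow> norm (\<xi> g) < d \<Longrightarrow>
      inv g \<in> U \<and> norm (\<xi> (inv g)) < \<delta> \<and> norm (\<xi> (inv g) + \<xi> g) \<le> \<epsilon> * norm (\<xi> g)"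
      using inverse_almost_minus by metis
    have "(\<lambda>n. norm (v /\<^sub>R real n)) \<longlonglongrightarrow> 0"
      by (rule tendsto_norm_zero[OF div_nat_limit])
    from order_tendstoD(2)[OF this d(1)] eventually_gt_at_top[of 0]
    show ?thesis
    proof eventually_elim
      case (elim n)
      note e = euler_props[OF v, of n]
      have a: "?a n \<in> U" "norm (\<xi> (?a n) + \<xi> (euler v n)) \<le> \<epsilon> * norm (\<xi> (euler v n))"
        using d(2)[OF e(1)] e(2) elim by auto
      have "real n *\<^sub>R \<xi> (?a n) - (- v) = real n *\<^sub>R (\<xi> (?a n) + \<xi> (euler v n))"
        using e(2) elim by (simp add: algebra_simps)
      then have "norm (real n *\<^sub>R \<xi> (?a n) - (- v)) = real n * norm (\<xi> (?a n) + \<xi> (euler v n))"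
        by simp
      also have "\<dots> \<le> real n * (\<epsilon> * norm (\<xi> (euler v n)))"
        by (intro mult_left_mono a) auto
      also have "\<dots> = \<epsilon> * norm v" using e(2) elim by simp
      finally show ?case using a by simp
    qed
  qed
  have aU: "\<forall>\<^sub>F n in sequentially. ?a n \<in> U" using ev[of 1] by (auto elim: eventually_mono)
  have lim: "(\<lambda>n. real n *\<^sub>R \<xi> (?a n)) \<longlonglongrightarrow> - v"
  proof (rule tendstoI)
    fix e :: real assume e: "e > 0"
    have nv: "norm v + 1 > 0" using norm_ge_zero[of v] by linarith
    then have "e / (norm v + 1) > 0" using e by simp
    from ev[OF this] show "\<forall>\<^sub>F n in sequentially. dist (real n *\<^sub>R \<xi> (?a n)) (- v) < e"
    proof eventually_elim
      case (elim n)
      have "e / (norm v + 1) * norm v < e" using e nv by (simp add: field_simps)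
      then show ?case using elim by (simp add: dist_norm)
    qed
  qed
  note P = pow_limit[OF v' aU lim]
  note E = local_exp_limit[OF v] and E' = local_exp_limit[OF v']
  have r: "norm (\<xi> (local_exp v)) < radius" "norm (\<xi> (local_exp (- v))) < radius"
    using E(3) E'(3) v radius_pos norm_ge_zero[of v] unfolding norm_minus_cancel by linarith+
  have "(\<lambda>n. \<xi> (euler v n [^] n \<otimes> ?a n [^] n)) \<longlonglongrightarrow> \<xi> (local_exp v \<otimes> local_exp (- v))"
    by (rule mult_limit[OF _ P(1) E(2) P(2) E(1) E'(1) r]) (use euler_power_bound[OF v] in auto)
  moreover have "euler v n [^] n \<otimes> ?a n [^] n = \<one>" for n
    using euler_props(1)[OF v, of n] by (simp add: nat_pow_inv)
  ultimately have "(\<lambda>n. 0) \<longlonglongrightarrow> \<xi> (local_exp v \<otimes> local_exp (- v))" by (simp add: coord_one)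
  then have "\<xi> (local_exp v \<otimes> local_exp (- v)) = 0" by (simp add: LIMSEQ_const_iff)
  moreover have "local_exp v \<otimes> local_exp (- v) \<in> U"
    by (rule mult_in_U[OF strict_radius E(1) E'(1) r])
  ultimately have "local_exp v \<otimes> local_exp (- v) = \<one>"
    using coord_eqD one_in coord_one by metis
  then have "inv (local_exp (- v)) = local_exp v"
    by (rule inv_equality) (use E(1) E'(1) in auto)
  moreover have "local_exp (- v) \<in> carrier G" using E'(1) by blast
  ultimately show ?thesis using inv_inv by metis
qed

text \<open>For a rational ratio \<open>k / n\<close>, both elements are powers of \<open>local_exp (v / n)\<close>. The general case
  follows by continuity.\<close>

lemma local_exp_commute_aux:
  assumes v: "norm v < radius / 64" and t: "0 \<le> t" "t \<le> 1"
  shows "local_exp v \<otimes> local_exp (t *\<^sub>R v) = local_exp (t *\<^sub>R v) \<otimes> local_exp v"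
proof -
  \<comment> \<open>\<open>k n / n\<close> is a rational approximation of \<open>t\<close> from below, so that it stays in \<open>[0, 1]\<close>.\<close>
  define k where "k n = nat \<lfloor>t * real n\<rfloor>" for n
  have k: "real (k n) \<le> t * real n" "t * real n - 1 \<le> real (k n)" for n
    unfolding k_def using t by (auto simp: of_nat_nat)
  define w where "w n = (real (k n) / real n) *\<^sub>R v" for n
  have tv: "norm (s *\<^sub>R v) < radius / 64" if "0 \<le> s" "s \<le> 1" for s
  proof -
    have "s * norm v \<le> 1 * norm v" by (rule mult_right_mono) (use that in auto)
    then show ?thesis using v that by simp
  qed
  have quot: "0 \<le> real (k n) / real n" "real (k n) / real n \<le> 1" for n
  proof -
    have "t * real n \<le> 1 * real n" by (rule mult_right_mono) (use t in auto)
    then show "real (k n) / real n \<le> 1" using k(1)[of n] by (auto simp: divide_le_eq)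
  qed auto
  have w: "norm (w n) < radius / 64" for n unfolding w_def by (rule tv[OF quot])
  have "(\<lambda>n. real (k n) / real n) \<longlonglongrightarrow> t"
  proof (rule tendsto_sandwich)
    show "\<forall>\<^sub>F n in sequentially. t - inverse (real n) \<le> real (k n) / real n"
      using eventually_gt_at_top[of 0]
    proof eventually_elim
      case (elim n)
      have "t - inverse (real n) = (t * real n - 1) / real n" using elim by (simp add: field_simps)
      also have "\<dots> \<le> real (k n) / real n" by (rule divide_right_mono[OF k(2)]) simp
      finally show ?case .
    qed
    show "\<forall>\<^sub>F n in sequentially. real (k n) / real n \<le> t"
      using eventually_gt_at_top[of 0]
    proof eventually_elim
      case (elim n)
      then show ?case using k(1)[of n] by (simp add: field_simps)
    qed
    show "(\<lambda>n. t - inverse (real n)) \<longlonglongrightarrow> t"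
      using tendsto_diff[OF tendsto_const lim_inverse_n, of t] by simp
  qed auto
  then have wlim: "w \<longlonglongrightarrow> t *\<^sub>R v" unfolding w_def by (intro tendsto_intros)
  let ?E = "local_exp v" and ?F = "local_exp (t *\<^sub>R v)"
  note E = local_exp_limit[OF v] and F = local_exp_limit[OF tv[OF t]]
  have F_lim: "(\<lambda>n. \<xi> (local_exp (w n))) \<longlonglongrightarrow> \<xi> ?F"
  proof -
    have "(\<lambda>n. 4 * norm (w n - t *\<^sub>R v)) \<longlonglongrightarrow> 0"
      using wlim by (auto intro!: tendsto_mult_right_zero tendsto_norm_zero simp: LIM_zero)
    then have "(\<lambda>n. \<xi> (local_exp (w n)) - \<xi> ?F) \<longlonglongrightarrow> 0"
      by (rule Lim_null_comparison[rotated]) (use local_exp_lipschitz[OF w tv[OF t]] in auto)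
    then show ?thesis by (simp add: LIM_zero_iff)
  qed
  have comm: "?E \<otimes> local_exp (w n) = local_exp (w n) \<otimes> ?E" if n: "n > 0" for n
  proof -
    let ?g = "local_exp (v /\<^sub>R real n)"
    have g: "?g \<in> carrier G" using norm_div_le[of n v] v by auto
    have "?E = ?g [^] n" using local_exp_pow[of n "v /\<^sub>R real n"] n v by simp
    moreover have "local_exp (w n) = ?g [^] k n"
    proof (cases "k n = 0")
      case True then show ?thesis by (simp add: w_def local_exp_zero)
    next
      case False
      have eq: "real (k n) *\<^sub>R (v /\<^sub>R real n) = w n"
        unfolding w_def scaleR_scaleR divide_inverse ..
      show ?thesis
        using local_exp_pow[of "k n" "v /\<^sub>R real n", unfolded eq, OF w] False by blast
    qed
    ultimately show ?thesis by (metis nat_pow_comm[OF g])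
  qed
  have r: "norm (\<xi> ?E) < radius" "norm (\<xi> ?F) < radius"
    using E(3) F(3) v tv[OF t] radius_pos norm_ge_zero[of v] by linarith+
  have U: "?E \<otimes> ?F \<in> U" "?F \<otimes> ?E \<in> U"
    using mult_in_U[OF strict_radius] E F r by blast+
  have 1: "(\<lambda>n. \<xi> (?E \<otimes> local_exp (w n))) \<longlonglongrightarrow> \<xi> (?E \<otimes> ?F)"
    by (rule mult_limit[OF _ _ _ F_lim E(1) F(1) r]) (use E w local_exp_limit in auto)
  have "(\<lambda>n. \<xi> (local_exp (w n) \<otimes> ?E)) \<longlonglongrightarrow> \<xi> (?F \<otimes> ?E)"
    by (rule mult_limit[OF _ _ F_lim _ F(1) E(1) r(2,1)]) (use E w local_exp_limit in auto)
  then have "(\<lambda>n. \<xi> (?E \<otimes> local_exp (w n))) \<longlonglongrightarrow> \<xi> (?F \<otimes> ?E)"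
    by (rule Lim_transform_eventually) (use eventually_gt_at_top[of 0] in eventually_elim, simp add: comm)
  with 1 have "\<xi> (?E \<otimes> ?F) = \<xi> (?F \<otimes> ?E)" using LIMSEQ_unique by blast
  then show ?thesis using coord_eqD U by blast
qed

lemma local_exp_commute:
  assumes s: "norm (s *\<^sub>R v) < radius / 64" and t: "norm (t *\<^sub>R v) < radius / 64"
  shows "local_exp (s *\<^sub>R v) \<otimes> local_exp (t *\<^sub>R v) = local_exp (t *\<^sub>R v) \<otimes> local_exp (s *\<^sub>R v)"
proof -
  have nonneg: "local_exp (s *\<^sub>R v) \<otimes> local_exp (t *\<^sub>R v) = local_exp (t *\<^sub>R v) \<otimes> local_exp (s *\<^sub>R v)"
    if s: "norm (s *\<^sub>R v) < radius / 64" and st: "\<bar>t\<bar> \<le> \<bar>s\<bar>" and sg: "0 \<le> s * t" for s t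
  proof (cases "s = 0")
    case False
    have q: "0 \<le> t / s" "t / s \<le> 1"
      using st sg False by (auto simp: zero_le_divide_iff zero_le_mult_iff divide_le_eq)
    show ?thesis using local_exp_commute_aux[OF s q] False by simp
  qed (use st local_exp_zero in auto)
  have gen: "local_exp (s *\<^sub>R v) \<otimes> local_exp (t *\<^sub>R v) = local_exp (t *\<^sub>R v) \<otimes> local_exp (s *\<^sub>R v)"
    if s: "norm (s *\<^sub>R v) < radius / 64" and st: "\<bar>t\<bar> \<le> \<bar>s\<bar>" for s t
  proof (cases "0 \<le> s * t")
    case True then show ?thesis using nonneg s st by blast
  next
    case False
    have t': "norm (t *\<^sub>R v) < radius / 64"
    proof -
      have "\<bar>t\<bar> * norm v \<le> \<bar>s\<bar> * norm v" by (rule mult_right_mono) (use st in auto)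
      then show ?thesis using s by simp
    qed
    let ?x = "local_exp (s *\<^sub>R v)" and ?y = "local_exp (t *\<^sub>R v)"
    have "?x \<otimes> local_exp ((- t) *\<^sub>R v) = local_exp ((- t) *\<^sub>R v) \<otimes> ?x"
      by (rule nonneg) (use s st False in auto)
    then have "?x \<otimes> inv ?y = inv ?y \<otimes> ?x"
      using local_exp_minus[OF t'] by simp
    moreover have "?x \<in> carrier G" "?y \<in> carrier G" using s t' by auto
    ultimately show ?thesis by (metis inv_solve_left inv_solve_right m_assoc inv_closed m_closed)
  qed
  show ?thesis using gen[of s t] gen[of t s] s t by (cases "\<bar>t\<bar> \<le> \<bar>s\<bar>") auto
qed

text \<open>The product of the \<open>n\<close>-th roots of the factors has coordinates \<open>(v + w) / n\<close> to first order, and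
  its \<open>n\<close>-th power splits because the roots commute.\<close>

lemma local_exp_add:
  assumes v: "norm v < radius / 64" and w: "norm w < radius / 64" and vw: "norm (v + w) < radius / 64"
    and comm: "\<And>n. n > 0 \<Longrightarrow> local_exp (v /\<^sub>R real n) \<otimes> local_exp (w /\<^sub>R real n)
        = local_exp (w /\<^sub>R real n) \<otimes> local_exp (v /\<^sub>R real n)"
  shows "local_exp (v + w) = local_exp v \<otimes> local_exp w"
proof -
  define a where "a n = local_exp (v /\<^sub>R real n) \<otimes> local_exp (w /\<^sub>R real n)" for n
  have sv: "norm (v /\<^sub>R real n) < radius / 64" and sw: "norm (w /\<^sub>R real n) < radius / 64" for n
    using norm_div_le[of n v] norm_div_le[of n w] v w by linarith+
  note Ev = local_exp_limit[OF sv] and Ew = local_exp_limit[OF sw]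
  have rv: "norm (\<xi> (local_exp (v /\<^sub>R real n))) < radius"
    and rw: "norm (\<xi> (local_exp (w /\<^sub>R real n))) < radius" for n
    using Ev(3)[of n] Ew(3)[of n] sv[of n] sw[of n] radius_pos by linarith+
  have aU: "a n \<in> U" for n
    unfolding a_def by (rule mult_in_U[OF strict_radius Ev(1) Ew(1) rv rw])
  have apow: "a n [^] n = local_exp v \<otimes> local_exp w" if "n > 0" for n
  proof -
    have "a n [^] n = local_exp (v /\<^sub>R real n) [^] n \<otimes> local_exp (w /\<^sub>R real n) [^] n"
      unfolding a_def
      by (rule pow_mult_distrib[OF comm[OF that] local_exp_in_carrier[OF sv] local_exp_in_carrier[OF sw]])
    moreover have "local_exp (v /\<^sub>R real n) [^] n = local_exp v"
      using local_exp_pow[of n "v /\<^sub>R real n"] that v by simp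
    moreover have "local_exp (w /\<^sub>R real n) [^] n = local_exp w"
      using local_exp_pow[of n "w /\<^sub>R real n"] that w by simp
    ultimately show ?thesis by (simp only:)
  qed
  have lim: "(\<lambda>n. real n *\<^sub>R \<xi> (a n)) \<longlonglongrightarrow> v + w"
  proof (rule tendstoI)
    fix e :: real assume e: "e > 0"
    let ?K = "norm v + 3 * norm w + 1"
    have K: "?K > 0" using norm_ge_zero[of v] norm_ge_zero[of w] by linarith
    define \<epsilon> where "\<epsilon> = min 1 (e / ?K)"
    have \<epsilon>: "\<epsilon> > 0" "\<epsilon> \<le> 1" using e K by (auto simp: \<epsilon>_def)
    have "\<epsilon> * (norm v + 3 * norm w) < \<epsilon> * ?K" using \<epsilon> by (simp add: algebra_simps)
    also have "\<dots> \<le> e / ?K * ?K" by (rule mult_right_mono) (use K in \<open>auto simp: \<epsilon>_def\<close>)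
    also have "\<dots> = e" using K by simp
    finally have \<epsilon>e: "\<epsilon> * (norm v + 3 * norm w) < e" .
    obtain \<delta> where \<delta>: "\<delta> > 0" "strict_approx \<xi> (\<otimes>) U \<epsilon> \<delta>" using strict[OF \<epsilon>(1)] by blast
    \<comment> \<open>Two errors for passing from \<open>v / n\<close> and \<open>w / n\<close> to their exponentials, and one for the product;
      the last is proportional to \<open>norm (\<xi> (local_exp (w / n)))\<close>, at most twice \<open>norm (w / n)\<close>.\<close>
    have "(\<lambda>n. 2 * norm (v /\<^sub>R real n)) \<longlonglongrightarrow> 0" "(\<lambda>n. 2 * norm (w /\<^sub>R real n)) \<longlonglongrightarrow> 0"
      by (intro tendsto_mult_right_zero tendsto_norm_zero div_nat_limit)+
    from order_tendstoD(2)[OF this(1) \<delta>(1)] order_tendstoD(2)[OF this(2) \<delta>(1)] eventually_gt_at_top[of 0]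
    show "\<forall>\<^sub>F n in sequentially. dist (real n *\<^sub>R \<xi> (a n)) (v + w) < e"
    proof eventually_elim
      case (elim n)
      let ?x = "v /\<^sub>R real n" and ?y = "w /\<^sub>R real n"
      have x: "norm (\<xi> (local_exp ?x) - ?x) \<le> \<epsilon> * norm ?x"
        by (rule local_exp_almost_id[OF \<delta>(2,1) \<epsilon>(2) sv elim(1)])
      have y: "norm (\<xi> (local_exp ?y) - ?y) \<le> \<epsilon> * norm ?y"
        by (rule local_exp_almost_id[OF \<delta>(2,1) \<epsilon>(2) sw elim(2)])
      have "norm (\<xi> (a n) - \<xi> (local_exp ?x) - \<xi> (local_exp ?y)) \<le> \<epsilon> * norm (\<xi> (local_exp ?y))"
        unfolding a_def
        by (rule mult_almost_add(1)[OF \<delta>(2) Ev(1) Ew(1)]) (use Ev(3)[of n] Ew(3)[of n] elim in linarith)+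
      also have "\<dots> \<le> \<epsilon> * (2 * norm ?y)"
        by (intro mult_left_mono Ew) (use \<epsilon> in auto)
      finally have z: "norm (\<xi> (a n) - \<xi> (local_exp ?x) - \<xi> (local_exp ?y)) \<le> \<epsilon> * (2 * norm ?y)" .
      have "norm (\<xi> (a n) - (?x + ?y)) \<le> \<epsilon> * (2 * norm ?y) + \<epsilon> * norm ?x + \<epsilon> * norm ?y"
      proof -
        have "\<xi> (a n) - (?x + ?y) = (\<xi> (a n) - \<xi> (local_exp ?x) - \<xi> (local_exp ?y))
            + (\<xi> (local_exp ?x) - ?x) + (\<xi> (local_exp ?y) - ?y)" by simp
        then show ?thesis using x y z norm_triangle_mono by metis
      qed
      then have 1: "norm (\<xi> (a n) - (?x + ?y)) \<le> \<epsilon> * ((norm v + 3 * norm w) / real n)"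
        using elim by (simp add: field_simps)
      have "dist (real n *\<^sub>R \<xi> (a n)) (v + w) = norm (real n *\<^sub>R (\<xi> (a n) - (?x + ?y)))"
        using elim by (simp add: dist_norm algebra_simps)
      also have "\<dots> = real n * norm (\<xi> (a n) - (?x + ?y))" by simp
      also have "\<dots> \<le> real n * (\<epsilon> * ((norm v + 3 * norm w) / real n))"
        by (rule mult_left_mono[OF 1]) auto
      also have "\<dots> = \<epsilon> * (norm v + 3 * norm w)" using elim by simp
      finally show ?case using \<epsilon>e by linarith
    qed
  qed
  have "(\<lambda>n. \<xi> (a n [^] n)) \<longlonglongrightarrow> \<xi> (local_exp (v + w))"
    by (rule pow_limit(2)[OF vw _ lim]) (use aU in auto)
  then have "(\<lambda>n. \<xi> (local_exp v \<otimes> local_exp w)) \<longlonglongrightarrow> \<xi> (local_exp (v + w))"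
    by (rule Lim_transform_eventually) (use eventually_gt_at_top[of 0] in eventually_elim, simp add: apow)
  then have "\<xi> (local_exp v \<otimes> local_exp w) = \<xi> (local_exp (v + w))" by (simp add: LIMSEQ_const_iff)
  moreover have "local_exp v \<otimes> local_exp w \<in> U" using aU[of 1] by (simp add: a_def)
  ultimately show ?thesis using coord_eqD local_exp_limit(1)[OF vw] by metis
qed

end

section \<open>The global exponential map\<close>

context coordinate_group begin

lemma eventually_small: "\<exists>N>0. \<forall>n\<ge>N. norm ((v :: 'e) /\<^sub>R real n) < radius / 64"
proof -
  have "0 < radius / 64" using radius_pos by simp
  from order_tendstoD(2)[OF tendsto_norm_zero[OF div_nat_limit[of v]] this]
  obtain N where "\<forall>n\<ge>N. norm (v /\<^sub>R real n) < radius / 64"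
    unfolding eventually_sequentially by blast
  then show ?thesis by (intro exI[of _ "Suc N"]) auto
qed

text \<open>The exponential of a small multiple \<open>v / N\<close>, raised to the power \<open>N\<close>. The choice of \<open>N\<close> is
  immaterial by \<open>Exp_eq\<close>.\<close>

definition Exp :: "'e \<Rightarrow> 'a"
  where "Exp v = (let N = LEAST n. n > 0 \<and> norm (v /\<^sub>R real n) < radius / 64
                  in local_exp (v /\<^sub>R real N) [^] N)"

lemma local_exp_subdivide:
  assumes n: "n > 0" "norm (v /\<^sub>R real n) < radius / 64" and m: "m > 0"
  shows "local_exp (v /\<^sub>R real (n * m)) [^] (n * m) = local_exp (v /\<^sub>R real n) [^] n"
proof -
  have eq: "(v /\<^sub>R real n) /\<^sub>R real m = v /\<^sub>R real (n * m)" by simp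
  have small: "norm (v /\<^sub>R real (n * m)) < radius / 64"
    using norm_div_le[of m "v /\<^sub>R real n"] n(2) unfolding eq by linarith
  have eq': "real m *\<^sub>R (v /\<^sub>R real (n * m)) = v /\<^sub>R real n" using m by (simp add: field_simps)
  have "local_exp (v /\<^sub>R real n) = local_exp (v /\<^sub>R real (n * m)) [^] m"
    using local_exp_pow[of m "v /\<^sub>R real (n * m)"] n m unfolding eq' by blast
  then show ?thesis using small by (simp add: nat_pow_pow mult.commute)
qed

lemma Exp_eq:
  assumes n: "n > 0" "norm (v /\<^sub>R real n) < radius / 64"
  shows "Exp v = local_exp (v /\<^sub>R real n) [^] n"
proof -
  let ?P = "\<lambda>n. n > 0 \<and> norm (v /\<^sub>R real n) < radius / 64"
  define N where "N = (LEAST n. ?P n)"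
  have "?P N" unfolding N_def by (rule LeastI[of ?P n]) (use n in auto)
  then have N: "N > 0" "norm (v /\<^sub>R real N) < radius / 64" by auto
  have "Exp v = local_exp (v /\<^sub>R real N) [^] N" unfolding Exp_def N_def Let_def ..
  also have "\<dots> = local_exp (v /\<^sub>R real (N * n)) [^] (N * n)"
    by (rule local_exp_subdivide[OF N n(1), symmetric])
  also have "\<dots> = local_exp (v /\<^sub>R real (n * N)) [^] (n * N)" by (simp only: mult.commute)
  also have "\<dots> = local_exp (v /\<^sub>R real n) [^] n" by (rule local_exp_subdivide[OF n N(1)])
  finally show ?thesis .
qed

lemma Exp_small: "norm v < radius / 64 \<Longrightarrow> Exp v = local_exp v"
  using Exp_eq[of 1 v] by simp

lemma Exp_carrier [simp, intro]: "Exp v \<in> carrier G"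
proof -
  obtain N where "N > 0" "\<forall>n\<ge>N. norm (v /\<^sub>R real n) < radius / 64" using eventually_small by blast
  then show ?thesis using Exp_eq[of N v] by auto
qed

lemma Exp_zero [simp]: "Exp 0 = \<one>"
  using Exp_small[of 0] radius_pos local_exp_zero by simp

lemma pow_commute:
  assumes "x \<otimes> y = y \<otimes> x" "x \<in> carrier G" "y \<in> carrier G"
  shows "x [^] (n :: nat) \<otimes> y [^] (m :: nat) = y [^] m \<otimes> x [^] n"
proof -
  have "x [^] n \<otimes> y = y \<otimes> x [^] n" by (rule group_commutes_pow[OF assms])
  then show ?thesis
    using group_commutes_pow[of y "x [^] n" m] assms by simp
qed

lemma Exp_commute: "Exp (s *\<^sub>R v) \<otimes> Exp (t *\<^sub>R v) = Exp (t *\<^sub>R v) \<otimes> Exp (s *\<^sub>R v)"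
proof -
  obtain N where N: "N > 0" "\<forall>n\<ge>N. norm ((s *\<^sub>R v) /\<^sub>R real n) < radius / 64"
    using eventually_small by blast
  obtain M where M: "M > 0" "\<forall>n\<ge>M. norm ((t *\<^sub>R v) /\<^sub>R real n) < radius / 64"
    using eventually_small by blast
  let ?n = "max N M"
  have n: "?n > 0" "norm ((s *\<^sub>R v) /\<^sub>R real ?n) < radius / 64" "norm ((t *\<^sub>R v) /\<^sub>R real ?n) < radius / 64"
    using N M by auto
  have "local_exp ((s *\<^sub>R v) /\<^sub>R real ?n) \<otimes> local_exp ((t *\<^sub>R v) /\<^sub>R real ?n)
      = local_exp ((t *\<^sub>R v) /\<^sub>R real ?n) \<otimes> local_exp ((s *\<^sub>R v) /\<^sub>R real ?n)"
    using local_exp_commute[of "inverse (real ?n) * s" v "inverse (real ?n) * t"] n by simp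
  then show ?thesis
    unfolding Exp_eq[OF n(1,2)] Exp_eq[OF n(1,3)]
    by (rule pow_commute[OF _ local_exp_in_carrier[OF n(2)] local_exp_in_carrier[OF n(3)]])
qed

text \<open>Commutation at equal times along the two rays suffices: \<open>local_exp_add\<close> only asks for the roots
  of the same order to commute.\<close>

lemma Exp_add:
  assumes comm: "\<And>t. Exp (t *\<^sub>R v) \<otimes> Exp (t *\<^sub>R w) = Exp (t *\<^sub>R w) \<otimes> Exp (t *\<^sub>R v)"
  shows "Exp (v + w) = Exp v \<otimes> Exp w"
proof -
  obtain N where N: "N > 0" "\<forall>n\<ge>N. norm (v /\<^sub>R real n) < radius / 64" using eventually_small by blast
  obtain M where M: "M > 0" "\<forall>n\<ge>M. norm (w /\<^sub>R real n) < radius / 64" using eventually_small by blast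
  obtain L where L: "L > 0" "\<forall>n\<ge>L. norm ((v + w) /\<^sub>R real n) < radius / 64"
    using eventually_small by blast
  define n where "n = max N (max M L)"
  let ?x = "v /\<^sub>R real n" and ?y = "w /\<^sub>R real n"
  have n: "n > 0" "norm ?x < radius / 64" "norm ?y < radius / 64"
    "norm ((v + w) /\<^sub>R real n) < radius / 64"
    using N M L by (auto simp: n_def)
  have eq: "(v + w) /\<^sub>R real n = ?x + ?y" by (simp add: scaleR_right_distrib)
  have "local_exp (?x /\<^sub>R real m) \<otimes> local_exp (?y /\<^sub>R real m)
      = local_exp (?y /\<^sub>R real m) \<otimes> local_exp (?x /\<^sub>R real m)" for m
  proof -
    have "norm (?x /\<^sub>R real m) < radius / 64" "norm (?y /\<^sub>R real m) < radius / 64"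
      using norm_div_le[of m ?x] norm_div_le[of m ?y] n by linarith+
    then show ?thesis
      using comm[of "inverse (real m) * inverse (real n)"] Exp_small by simp
  qed
  then have "local_exp (?x + ?y) = local_exp ?x \<otimes> local_exp ?y"
    by (intro local_exp_add n n(4)[unfolded eq])
  then have "Exp (v + w) = (local_exp ?x \<otimes> local_exp ?y) [^] n"
    using Exp_eq[OF n(1,4)] by (simp only: eq)
  also have "\<dots> = local_exp ?x [^] n \<otimes> local_exp ?y [^] n"
    by (rule pow_mult_distrib) (use n comm[of "inverse (real n)"] in \<open>auto simp: Exp_small\<close>)
  finally show ?thesis unfolding Exp_eq[OF n(1,2)] Exp_eq[OF n(1,3)] .
qed

lemma Exp_ray_add: "Exp ((s + t) *\<^sub>R v) = Exp (s *\<^sub>R v) \<otimes> Exp (t *\<^sub>R v)"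
  unfolding scaleR_left_distrib
  by (rule Exp_add, unfold scaleR_scaleR, rule Exp_commute)

lemma Exp_minus: "Exp (- v) = inv (Exp v)"
proof -
  have "Exp (- v) \<otimes> Exp v = \<one>" using Exp_ray_add[of "-1" 1 v] by simp
  then have "inv (Exp v) = Exp (- v)" by (rule inv_equality) auto
  then show ?thesis ..
qed

text \<open>As \<open>\<gamma> t\<close> is the \<open>n\<close>-th power of \<open>\<gamma> (t / n)\<close>, which has coordinates \<open>t v / n\<close> to first order, it
  is equal to the limit of these powers.\<close>

lemma Exp_unique:
  fixes \<gamma> :: "real \<Rightarrow> 'a"
  assumes carrier: "\<And>t. \<gamma> t \<in> carrier G" and add: "\<And>s t. \<gamma> (s + t) = \<gamma> s \<otimes> \<gamma> t"
    and U: "\<forall>\<^sub>F t in at 0. \<gamma> t \<in> U"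
    and deriv: "((\<lambda>t. \<xi> (\<gamma> t)) has_vector_derivative v) (at 0)"
  shows "\<gamma> t = Exp (t *\<^sub>R v)"
proof -
  have zero: "\<gamma> 0 = \<one>" using add[of 0 0] carrier[of 0] by simp
  have pow: "\<gamma> (real n * t) = \<gamma> t [^] n" for n t
  proof (induction n)
    case (Suc n)
    have "\<gamma> (real (Suc n) * t) = \<gamma> (real n * t + t)" by (simp add: algebra_simps)
    then show ?case using Suc add by simp
  qed (simp add: zero)
  have quot: "((\<lambda>h. \<xi> (\<gamma> h) /\<^sub>R h) \<longlongrightarrow> v) (at 0)"
  proof (rule LIM_zero_cancel, rule tendsto_norm_zero_cancel)
    have "((\<lambda>h. norm ((\<xi> (\<gamma> h) - h *\<^sub>R v) /\<^sub>R \<bar>h\<bar>)) \<longlongrightarrow> 0) (at 0)"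
      using deriv zero coord_one
      by (intro tendsto_norm_zero) (simp add: has_vector_derivative_def has_derivative_at_within)
    then show "((\<lambda>h. norm (\<xi> (\<gamma> h) /\<^sub>R h - v)) \<longlongrightarrow> 0) (at 0)"
    proof (rule Lim_transform_eventually)
      have "norm ((\<xi> (\<gamma> h) - h *\<^sub>R v) /\<^sub>R \<bar>h\<bar>) = norm (\<xi> (\<gamma> h) /\<^sub>R h - v)" if "h \<noteq> 0" for h
      proof -
        have "\<xi> (\<gamma> h) /\<^sub>R h - v = (\<xi> (\<gamma> h) - h *\<^sub>R v) /\<^sub>R h" using that by (simp add: algebra_simps)
        then show ?thesis by simp
      qed
      then show "\<forall>\<^sub>F h in at 0. norm ((\<xi> (\<gamma> h) - h *\<^sub>R v) /\<^sub>R \<bar>h\<bar>) = norm (\<xi> (\<gamma> h) /\<^sub>R h - v)"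
        by (auto simp: eventually_at_filter)
    qed
  qed
  have local: "\<gamma> t = local_exp (t *\<^sub>R v)" if t: "norm (t *\<^sub>R v) < radius / 64" "t \<noteq> 0" for t
  proof -
    have at0: "filterlim (\<lambda>n. t / real n) (at 0) sequentially"
      unfolding filterlim_at
      using tendsto_divide_0[OF tendsto_const filterlim_real_sequentially[THEN filterlim_at_top_imp_at_infinity], of t]
        eventually_gt_at_top[of 0] t(2) by (auto elim!: eventually_mono)
    have aU: "\<forall>\<^sub>F n in sequentially. \<gamma> (t / real n) \<in> U"
      using filterlim_iff[THEN iffD1, OF at0] U by blast
    have "(\<lambda>n. t *\<^sub>R (\<xi> (\<gamma> (t / real n)) /\<^sub>R (t / real n))) \<longlonglongrightarrow> t *\<^sub>R v"
      by (intro tendsto_scaleR tendsto_const filterlim_compose[OF quot at0])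
    then have lim: "(\<lambda>n. real n *\<^sub>R \<xi> (\<gamma> (t / real n))) \<longlonglongrightarrow> t *\<^sub>R v"
      by (rule Lim_transform_eventually)
         (use eventually_gt_at_top[of 0] in eventually_elim, use t in \<open>simp add: field_simps\<close>)
    note P = pow_limit[OF t(1) aU lim]
    have ev: "\<forall>\<^sub>F n in sequentially. \<gamma> (t / real n) [^] n = \<gamma> t"
      using eventually_gt_at_top[of 0] by eventually_elim (simp flip: pow)
    then have "\<forall>\<^sub>F n in sequentially. \<gamma> t \<in> U" using P(1) by eventually_elim simp
    then have tU: "\<gamma> t \<in> U" by simp
    have "(\<lambda>n. \<xi> (\<gamma> t)) \<longlonglongrightarrow> \<xi> (local_exp (t *\<^sub>R v))"
      by (rule Lim_transform_eventually[OF P(2)]) (use ev in eventually_elim, simp)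
    then have "\<xi> (\<gamma> t) = \<xi> (local_exp (t *\<^sub>R v))" by (simp add: LIMSEQ_const_iff)
    then show ?thesis by (rule coord_eqD[OF tU local_exp_limit(1)[OF t(1)]])
  qed
  show ?thesis
  proof (cases "t = 0")
    case False
    obtain N where N: "N > 0" "\<forall>n\<ge>N. norm ((t *\<^sub>R v) /\<^sub>R real n) < radius / 64"
      using eventually_small by blast
    then have s: "norm ((t *\<^sub>R v) /\<^sub>R real N) < radius / 64" by blast
    have eq: "(t *\<^sub>R v) /\<^sub>R real N = (t / real N) *\<^sub>R v" by (simp add: divide_inverse mult.commute)
    have "\<gamma> t = \<gamma> (t / real N) [^] N" using pow[of N "t / real N"] N by simp
    also have "\<gamma> (t / real N) = local_exp ((t *\<^sub>R v) /\<^sub>R real N)"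
      unfolding eq by (rule local) (use s eq False N in auto)
    also have "\<dots> [^] N = Exp (t *\<^sub>R v)" by (rule Exp_eq[OF N(1) s, symmetric])
    finally show ?thesis .
  qed (simp add: zero)
qed

lemma Exp_has_derivative: "((\<lambda>v. \<xi> (Exp v)) has_derivative (\<lambda>v. v)) (at 0)"
  unfolding has_derivative_at_alt
proof (intro conjI allI impI)
  fix e :: real assume e: "e > 0"
  then obtain \<delta> where \<delta>: "\<delta> > 0" "strict_approx \<xi> (\<otimes>) U (min 1 e) \<delta>" using strict[of "min 1 e"] by auto
  show "\<exists>d>0. \<forall>y. norm (y - 0) < d \<longrightarrow> norm (\<xi> (Exp y) - \<xi> (Exp 0) - (y - 0)) \<le> e * norm (y - 0)"
  proof (intro exI[of _ "min (radius / 64) (\<delta> / 2)"] conjI allI impI)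
    fix y :: 'e assume y: "norm (y - 0) < min (radius / 64) (\<delta> / 2)"
    then have "norm (\<xi> (local_exp y) - y) \<le> min 1 e * norm y"
      by (intro local_exp_almost_id[OF \<delta>(2,1)]) auto
    also have "\<dots> \<le> e * norm y" by (rule mult_right_mono) auto
    finally show "norm (\<xi> (Exp y) - \<xi> (Exp 0) - (y - 0)) \<le> e * norm (y - 0)"
      using y by (simp add: Exp_small coord_one)
  qed (use \<delta> radius_pos in auto)
qed (rule bounded_linear_ident)

lemma Exp_small_in_U: "norm v < radius / 64 \<Longrightarrow> Exp v \<in> U"
  using Exp_small local_exp_limit(1) by simp

lemma Exp_ray_has_vector_derivative:
  "((\<lambda>t. \<xi> (Exp (t *\<^sub>R v))) has_vector_derivative v) (at 0)"
proof -
  have "((\<lambda>t. t *\<^sub>R v) has_derivative (\<lambda>t. t *\<^sub>R v)) (at 0)"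
    by (rule bounded_linear_imp_has_derivative[OF bounded_linear_scaleR_left])
  from has_derivative_compose[OF this, of "\<lambda>v. \<xi> (Exp v)" "\<lambda>v. v"] Exp_has_derivative
  show ?thesis by (simp add: has_vector_derivative_def)
qed

text \<open>The map is continuous near \<open>0\<close> with the identity as derivative at \<open>0\<close>. By the open mapping theorem
  that rests on Brouwer's fixed point theorem, this suffices for the image to be a neighbourhood.\<close>

lemma Exp_covers_nbhd: "\<exists>W. openin T W \<and> \<one> \<in> W \<and> W \<subseteq> range Exp"
proof -
  let ?S = "ball (0 :: 'e) (radius / 64)"
  let ?f = "\<lambda>v. \<xi> (Exp v)"
  have cont: "continuous_on ?S ?f"
  proof (rule continuous_onI)
    fix x e :: "'e" and \<epsilon> :: real assume x: "x \<in> ?S" and "\<epsilon> > 0"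
    then show "\<exists>d>0. \<forall>x'\<in>?S. dist x' x < d \<longrightarrow> dist (?f x') (?f x) \<le> \<epsilon>"
      by (intro exI[of _ "\<epsilon> / 4"])
         (auto simp: dist_norm Exp_small intro!: order_trans[OF local_exp_lipschitz])
  qed
  have "?f 0 \<in> interior (?f ` ?S)"
    by (rule sussmann_open_mapping[OF _ cont _ Exp_has_derivative bounded_linear_ident])
       (use radius_pos in auto)
  then obtain d where d: "d > 0" "ball 0 d \<subseteq> ?f ` ?S"
    unfolding mem_interior by (auto simp: coord_one)
  have "{g \<in> U. norm (\<xi> g) < d} \<subseteq> range Exp"
  proof
    fix g assume "g \<in> {g \<in> U. norm (\<xi> g) < d}"
    then have g: "g \<in> U" "\<xi> g \<in> ball 0 d" by auto
    then obtain v where "v \<in> ?S" "\<xi> g = ?f v" using d by blast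
    then have "g = Exp v" using coord_eqD[OF g(1)] Exp_small_in_U by simp
    then show "g \<in> range Exp" by blast
  qed
  moreover have "\<one> \<in> {g \<in> U. norm (\<xi> g) < d}" using d one_in coord_one by simp
  ultimately show ?thesis using open_coord_ball[OF d(1)] by blast
qed

lemma mult_continuous_map:
  assumes "continuous_map X T f" "continuous_map X T g"
  shows "continuous_map X T (\<lambda>x. f x \<otimes> g x)"
proof -
  have "continuous_map X (prod_topology T T) (\<lambda>x. (f x, g x))"
    using assms by (simp add: continuous_map_pairedI)
  from continuous_map_compose[OF this mult_continuous] show ?thesis by (simp add: o_def)
qed

lemma inv_continuous_map:
  assumes "continuous_map X T f"
  shows "continuous_map X T (\<lambda>x. inv (f x))"
  using continuous_map_compose[OF assms inv_continuous] by (simp add: o_def)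

lemma openin_translate:
  assumes a: "a \<in> carrier G" and W: "openin T W"
  shows "openin T {g \<in> carrier G. a \<otimes> g \<in> W}"
proof -
  have "continuous_map T T (\<lambda>g. a \<otimes> g)"
    by (intro mult_continuous_map) (use a in \<open>auto simp: topspace_carrier\<close>)
  from openin_continuous_map_preimage[OF this W] show ?thesis by (simp add: topspace_carrier)
qed

text \<open>Continuity at \<open>t\<close> reduces to time \<open>0\<close> by translation.\<close>

lemma Exp_ray_continuous: "continuous_map euclideanreal T (\<lambda>t. Exp (t *\<^sub>R v))"
  unfolding continuous_map_def
proof (intro conjI allI impI)
  fix W assume W: "openin T W"
  have "open {t. Exp (t *\<^sub>R v) \<in> W}"
    unfolding open_dist
  proof (intro ballI)
    fix t assume t: "t \<in> {t. Exp (t *\<^sub>R v) \<in> W}"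
    let ?W = "{g \<in> carrier G. Exp (t *\<^sub>R v) \<otimes> g \<in> W}"
    have "openin T ?W" by (rule openin_translate[OF _ W]) auto
    moreover have "\<one> \<in> ?W" using t by simp
    ultimately obtain d where d: "d > 0" "{g \<in> U. norm (\<xi> g) < d} \<subseteq> ?W"
      using coord_ball_nbhd by blast
    \<comment> \<open>Below \<open>d / 2\<close>, because coordinates of exponentials may be twice as long as the vector.\<close>
    define e where "e = min (radius / 64) (d / 2) / (norm v + 1)"
    have pos: "norm v + 1 > 0" using norm_ge_zero[of v] by linarith
    then have e: "e > 0" using d radius_pos by (simp add: e_def)
    show "\<exists>e>0. \<forall>y. dist y t < e \<longrightarrow> y \<in> {t. Exp (t *\<^sub>R v) \<in> W}"
    proof (intro exI[of _ e] conjI allI impI e)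
      fix y assume "dist y t < e"
      then have "\<bar>y - t\<bar> * (norm v + 1) < min (radius / 64) (d / 2)"
        using pos by (simp add: e_def dist_real_def pos_less_divide_eq)
      moreover have "\<bar>y - t\<bar> * norm v \<le> \<bar>y - t\<bar> * (norm v + 1)" by (rule mult_left_mono) auto
      ultimately have small: "norm ((y - t) *\<^sub>R v) < radius / 64" "norm ((y - t) *\<^sub>R v) < d / 2"
        by (auto simp del: min_less_iff_conj simp: min_def split: if_splits)
      then have "Exp ((y - t) *\<^sub>R v) \<in> {g \<in> U. norm (\<xi> g) < d}"
        using local_exp_limit[OF small(1)] by (simp add: Exp_small)
      then have "Exp (t *\<^sub>R v) \<otimes> Exp ((y - t) *\<^sub>R v) \<in> W" using d by blast
      then show "y \<in> {t. Exp (t *\<^sub>R v) \<in> W}" using Exp_ray_add[of t "y - t" v] by simp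
    qed
  qed
  then show "openin euclideanreal {x \<in> topspace euclideanreal. Exp (x *\<^sub>R v) \<in> W}" by simp
qed (auto simp: topspace_carrier)

end

section \<open>Precompact subgroups of connected nilpotent groups\<close>

lemma lower_central_series_subset:
  assumes "group G"
  shows "lower_central_series G i \<subseteq> carrier G"
proof -
  interpret group G by fact
  show ?thesis
  proof (induction i)
    case (Suc i)
    then show ?case
      unfolding lower_central_series.simps by (intro generate_incl) auto
  qed simp
qed

context coordinate_group begin

text \<open>Squaring multiplies the size of the coordinates by at least \<open>3/2\<close> as long as they are small.
  So the powers \<open>g\<^bsup>2^n\<^esup>\<close> of a nontrivial element leave \<open>V\<close>.\<close>

lemma no_small_subgroups:
  "\<exists>V. openin T V \<and> \<one> \<in> V \<and> (\<forall>g\<in>carrier G. (\<forall>n :: nat. g [^] n \<in> V) \<longrightarrow> g = \<one>)"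
proof -
  obtain \<delta> where \<delta>: "\<delta> > 0" "strict_approx \<xi> (\<otimes>) U (1/2) \<delta>" using strict[of "1/2"] by auto
  let ?V = "{g \<in> U. norm (\<xi> g) < \<delta>}"
  have "g = \<one>" if gc: "g \<in> carrier G" and g: "\<And>n :: nat. g [^] n \<in> ?V" for g
  proof -
    have pow: "(3/2) ^ n * norm (\<xi> g) \<le> norm (\<xi> (g [^] (2 ^ n :: nat)))" for n
    proof (induction n)
      case 0
      then show ?case using gc by simp
    next
      case (Suc n)
      let ?h = "g [^] (2 ^ n :: nat)"
      have h: "?h \<in> U" "norm (\<xi> ?h) < \<delta>" using g by blast+
      have "g [^] (2 ^ Suc n :: nat) = ?h \<otimes> ?h" using gc by (simp add: nat_pow_mult mult_2)
      then have "norm (\<xi> (g [^] (2 ^ Suc n :: nat)) - \<xi> ?h - \<xi> ?h) \<le> 1/2 * norm (\<xi> ?h)"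
        using mult_almost_add(1)[OF \<delta>(2) h(1) h(1) h(2) h(2)] by simp
      moreover have "norm (\<xi> ?h + \<xi> ?h) = 2 * norm (\<xi> ?h)"
        by (metis norm_scaleR abs_numeral scaleR_2)
      ultimately have "3/2 * norm (\<xi> ?h) \<le> norm (\<xi> (g [^] (2 ^ Suc n :: nat)))"
        using norm_triangle_ineq2[of "\<xi> ?h + \<xi> ?h" "\<xi> (g [^] (2 ^ Suc n :: nat))"]
        by (simp add: norm_minus_commute algebra_simps)
      then show ?case using Suc by simp
    qed
    have "norm (\<xi> g) = 0"
    proof (rule ccontr)
      assume "norm (\<xi> g) \<noteq> 0"
      then have p: "norm (\<xi> g) > 0" by simp
      obtain n where "\<delta> / norm (\<xi> g) < (3/2) ^ n" using real_arch_pow[of "3/2"] by auto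
      then have "\<delta> < (3/2) ^ n * norm (\<xi> g)" using p by (simp add: field_simps)
      moreover have "norm (\<xi> (g [^] (2 ^ n :: nat))) < \<delta>" using g by blast
      ultimately show False using pow[of n] by linarith
    qed
    moreover have "g \<in> U" using g[of 1] gc by simp
    ultimately show "g = \<one>" using coord_eqD one_in coord_one by simp
  qed
  then show ?thesis
    using open_coord_ball[OF \<delta>(1)] \<delta>(1) one_in coord_one by (intro exI[of _ ?V] conjI) auto
qed

text \<open>The tube lemma: the commutator map sends \<open>{\<one>} \<times> K\<close> to the identity.\<close>

lemma commutator_small:
  assumes K: "compactin T K" and V: "openin T V" "\<one> \<in> V"
  shows "\<exists>W. openin T W \<and> \<one> \<in> W \<and> (\<forall>z\<in>W. \<forall>k\<in>K. z \<otimes> k \<otimes> inv z \<otimes> inv k \<in> V)"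
proof -
  let ?f = "\<lambda>(z, k). z \<otimes> k \<otimes> inv z \<otimes> inv k"
  have "continuous_map (prod_topology T T) T (\<lambda>p. fst p \<otimes> snd p \<otimes> inv (fst p) \<otimes> inv (snd p))"
    by (intro mult_continuous_map inv_continuous_map continuous_map_fst continuous_map_snd)
  then have "continuous_map (prod_topology T T) T ?f" by (simp add: case_prod_unfold)
  from openin_continuous_map_preimage[OF this V(1)]
  have op: "openin (prod_topology T T) {p \<in> topspace (prod_topology T T). ?f p \<in> V}" .
  have Kc: "K \<subseteq> carrier G" using compactin_subset_topspace[OF K] topspace_carrier by simp
  have "{\<one>} \<times> K \<subseteq> {p \<in> topspace (prod_topology T T). ?f p \<in> V}"
    using Kc V by (auto simp: topspace_carrier)
  from tube_lemma_right[OF op K _ this] obtain W W'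
    where W: "openin T W" "\<one> \<in> W" "K \<subseteq> W'"
      "W \<times> W' \<subseteq> {p \<in> topspace (prod_topology T T). ?f p \<in> V}"
    by (auto simp: topspace_carrier)
  show ?thesis
  proof (intro exI[of _ W] conjI ballI W(1,2))
    fix z k assume "z \<in> W" "k \<in> K"
    then have "(z, k) \<in> W \<times> W'" using W(3) by blast
    then have "?f (z, k) \<in> V" using W(4) by blast
    then show "z \<otimes> k \<otimes> inv z \<otimes> inv k \<in> V" by simp
  qed
qed

text \<open>If \<open>c = [z, k]\<close> commutes with \<open>k\<close>, then conjugation by \<open>z\<close> maps \<open>k\<^sup>n\<close> to
  \<open>(c k)\<^sup>n = c\<^sup>n k\<^sup>n\<close>.\<close>

lemma commutator_pow:
  assumes z: "z \<in> carrier G" and k: "k \<in> carrier G"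
    and comm: "z \<otimes> k \<otimes> inv z \<otimes> inv k \<otimes> k = k \<otimes> (z \<otimes> k \<otimes> inv z \<otimes> inv k)"
  shows "z \<otimes> k [^] (n :: nat) \<otimes> inv z \<otimes> inv (k [^] n) = (z \<otimes> k \<otimes> inv z \<otimes> inv k) [^] n"
proof -
  define c where "c = z \<otimes> k \<otimes> inv z \<otimes> inv k"
  have c: "c \<in> carrier G" using z k by (simp add: c_def)
  have ck: "c \<otimes> k = k \<otimes> c" using comm by (simp add: c_def)
  have "c \<otimes> k = z \<otimes> k \<otimes> inv z" using z k by (simp add: c_def m_assoc)
  then have conj: "z \<otimes> k \<otimes> inv z = c \<otimes> k" by (rule sym)
  have "z \<otimes> k [^] n \<otimes> inv z = (z \<otimes> k \<otimes> inv z) [^] n"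
  proof (induction n)
    case (Suc n)
    have "z \<otimes> k [^] Suc n \<otimes> inv z = (z \<otimes> k [^] n \<otimes> inv z) \<otimes> (z \<otimes> k \<otimes> inv z)"
    proof -
      have "inv z \<otimes> (z \<otimes> (k \<otimes> inv z)) = k \<otimes> inv z"
        using z k by (simp flip: m_assoc)
      then show ?thesis using z k by (simp add: m_assoc)
    qed
    then show ?case using Suc by simp
  qed (use z in simp)
  also have "\<dots> = c [^] n \<otimes> k [^] n" unfolding conj by (rule pow_mult_distrib[OF ck c k])
  finally have "z \<otimes> k [^] n \<otimes> inv z = c [^] n \<otimes> k [^] n" .
  then show ?thesis using c k by (simp add: m_assoc flip: c_def)
qed

text \<open>Such a subgroup and its complement are both unions of translates of \<open>W\<close> and hence open.\<close>

lemma subgroup_containing_nbhd: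
  assumes conn: "connected_space T" and S: "subgroup S G"
    and W: "openin T W" "\<one> \<in> W" "W \<subseteq> S"
  shows "S = carrier G"
proof -
  interpret S: subgroup S G by fact
  have left: "openin T {g \<in> carrier G. inv x \<otimes> g \<in> W}" "x \<in> {g \<in> carrier G. inv x \<otimes> g \<in> W}"
    if "x \<in> carrier G" for x
    using openin_translate[OF _ W(1), of "inv x"] that W(2) by auto
  have "openin T S"
  proof (subst openin_subopen, intro ballI)
    fix s assume s: "s \<in> S"
    then have sc: "s \<in> carrier G" by simp
    have "g \<in> S" if "g \<in> carrier G" "inv s \<otimes> g \<in> W" for g
    proof -
      have "s \<otimes> (inv s \<otimes> g) \<in> S" using that W s by blast
      then show ?thesis using that sc by (simp flip: m_assoc)
    qed
    then show "\<exists>T'. openin T T' \<and> s \<in> T' \<and> T' \<subseteq> S"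
      using left[OF sc] by blast
  qed
  moreover have "openin T (carrier G - S)"
  proof (subst openin_subopen, intro ballI)
    fix x assume x: "x \<in> carrier G - S"
    then have xc: "x \<in> carrier G" by simp
    have "g \<notin> S" if g: "g \<in> carrier G" "inv x \<otimes> g \<in> W" for g
    proof
      assume gS: "g \<in> S"
      have w: "inv x \<otimes> g \<in> S" using g W by blast
      have "g \<otimes> inv (inv x \<otimes> g) = x"
        using g xc by (simp add: inv_mult_group flip: m_assoc)
      moreover have "g \<otimes> inv (inv x \<otimes> g) \<in> S" using gS w by blast
      ultimately show False using x by simp
    qed
    then show "\<exists>T'. openin T T' \<and> x \<in> T' \<and> T' \<subseteq> carrier G - S"
      using left[OF xc] by blast
  qed
  ultimately have "S = {} \<or> S = topspace T"
    using conn S.subset unfolding connected_space_clopen_in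
    by (auto simp: closedin_def topspace_carrier)
  then show ?thesis using S.one_closed topspace_carrier by blast
qed

lemma centralizer_subgroup:
  assumes H: "H \<subseteq> carrier G"
  shows "subgroup {z \<in> carrier G. \<forall>k\<in>H. z \<otimes> k = k \<otimes> z} G"
proof (rule subgroupI)
  fix a assume a: "a \<in> {z \<in> carrier G. \<forall>k\<in>H. z \<otimes> k = k \<otimes> z}"
  have "inv a \<otimes> k = k \<otimes> inv a" if k: "k \<in> H" for k
  proof -
    have kc: "k \<in> carrier G" and ac: "a \<in> carrier G" and c: "a \<otimes> k = k \<otimes> a" using k H a by auto
    have "inv a \<otimes> (k \<otimes> a) \<otimes> inv a = k \<otimes> inv a"
      using kc ac by (simp add: c[symmetric]) (simp flip: m_assoc)
    then show ?thesis using kc ac by (simp add: m_assoc)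
  qed
  then show "inv a \<in> {z \<in> carrier G. \<forall>k\<in>H. z \<otimes> k = k \<otimes> z}" using a by simp
next
  fix a b assume a: "a \<in> {z \<in> carrier G. \<forall>k\<in>H. z \<otimes> k = k \<otimes> z}"
    and b: "b \<in> {z \<in> carrier G. \<forall>k\<in>H. z \<otimes> k = k \<otimes> z}"
  have "a \<otimes> b \<otimes> k = k \<otimes> (a \<otimes> b)" if k: "k \<in> H" for k
  proof -
    have c: "k \<in> carrier G" "a \<in> carrier G" "b \<in> carrier G" using k H a b by auto
    have "a \<otimes> b \<otimes> k = a \<otimes> (k \<otimes> b)" using c b k by (simp add: m_assoc)
    also have "\<dots> = (a \<otimes> k) \<otimes> b" using c by (simp add: m_assoc)
    also have "\<dots> = k \<otimes> (a \<otimes> b)" using c a k by (simp add: m_assoc)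
    finally show ?thesis .
  qed
  then show "a \<otimes> b \<in> {z \<in> carrier G. \<forall>k\<in>H. z \<otimes> k = k \<otimes> z}" using a b by simp
next
  have "\<one> \<in> {z \<in> carrier G. \<forall>k\<in>H. z \<otimes> k = k \<otimes> z}" using H by auto
  then show "{z \<in> carrier G. \<forall>k\<in>H. z \<otimes> k = k \<otimes> z} \<noteq> {}" by blast
qed auto

text \<open>Downward induction on the term of the lower central series in which a neighbourhood of the
  identity is known to centralize \<open>H\<close>, starting from the trivial term. In the induction step, \<open>c = [z, k]\<close>
  lies in the next term and is small, hence commutes with \<open>k\<close>; thus all \<open>c\<^sup>n = [z, k\<^sup>n]\<close> are small as
  well, and \<open>c\<close> is trivial.\<close>

lemma precompact_subgroup_central:
  assumes nil: "nilpotent_group G" and conn: "connected_space T"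
    and H: "subgroup H G" "H \<subseteq> K" and K: "compactin T K"
    and x: "x \<in> carrier G" and h: "h \<in> H"
  shows "x \<otimes> h = h \<otimes> x"
proof -
  interpret H: subgroup H G by fact
  let ?Z = "\<lambda>z. \<forall>k\<in>H. z \<otimes> k = k \<otimes> z"
  let ?L = "lower_central_series G"
  let ?P = "\<lambda>i. \<exists>W. openin T W \<and> \<one> \<in> W \<and> (\<forall>z \<in> W \<inter> ?L i. ?Z z)"
  have Lc: "?L i \<subseteq> carrier G" for i by (rule lower_central_series_subset) (rule is_group)
  \<comment> \<open>For \<open>z\<close> in \<open>?L i\<close>, the commutators \<open>?c k\<close> lie in \<open>?L (Suc i)\<close>, where the assumption applies.\<close>
  have step: "?P i" if "?P (Suc i)" for i
  proof -
    from that obtain W where W: "openin T W" "\<one> \<in> W" "\<forall>z \<in> W \<inter> ?L (Suc i). ?Z z"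
      by (elim exE conjE)
    obtain V where V: "openin T V" "\<one> \<in> V"
      "\<forall>g\<in>carrier G. (\<forall>n :: nat. g [^] n \<in> V) \<longrightarrow> g = \<one>"
      using no_small_subgroups by (elim exE conjE)
    have WV: "openin T (W \<inter> V)" "\<one> \<in> W \<inter> V" using W(1,2) V(1,2) by auto
    obtain W' where W': "openin T W'" "\<one> \<in> W'"
      "\<forall>z\<in>W'. \<forall>k\<in>K. z \<otimes> k \<otimes> inv z \<otimes> inv k \<in> W \<inter> V"
      using commutator_small[OF K WV] by (elim exE conjE)
    have "z \<otimes> k = k \<otimes> z" if z: "z \<in> W'" "z \<in> ?L i" and k: "k \<in> H" for z k
    proof -
      let ?c = "\<lambda>k. z \<otimes> k \<otimes> inv z \<otimes> inv k"
      have zc: "z \<in> carrier G" using z Lc by blast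
      have kc: "k \<in> carrier G" using k by simp
      have kK: "k \<in> K" using k H(2) by blast
      have "?c k \<in> ?L (Suc i)"
        unfolding lower_central_series.simps by (rule generate.incl) (use z kc in blast)
      then have "?c k \<in> W \<inter> ?L (Suc i)" using W'(3) z(1) kK by simp
      then have "?c k \<otimes> k = k \<otimes> ?c k" by (rule W(3)[THEN bspec, THEN bspec, OF _ k])
      from commutator_pow[OF zc kc this]
      have "?c k [^] n = ?c (k [^] n)" for n :: nat by (rule sym)
      moreover have "k [^] n \<in> K" for n :: nat
      proof -
        have "k [^] n \<in> H" by (induction n) (use k in simp_all)
        then show ?thesis using H(2) by blast
      qed
      ultimately have "?c k [^] n \<in> V" for n :: nat using W'(3) z(1) by simp
      then have "?c k = \<one>" using V(3) zc kc by simp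
      then have "(z \<otimes> k) \<otimes> inv (k \<otimes> z) = \<one>" using zc kc by (simp add: inv_mult_group m_assoc)
      then show ?thesis using zc kc by (simp add: inv_solve_right')
    qed
    then have "\<forall>z \<in> W' \<inter> ?L i. ?Z z" by (intro ballI) blast
    then show ?thesis using W'(1,2) by (intro exI[of _ W'] conjI)
  qed
  obtain n where n: "?L n = {\<one>}" using nil unfolding nilpotent_group_def by blast
  have "?P n" using n H.subset openin_topspace[of T]
    by (intro exI[of _ "carrier G"]) (auto simp: topspace_carrier)
  then have "?P 0"
  proof (induction n)
    case (Suc n)
    show ?case by (rule Suc.IH[OF step[OF Suc.prems]])
  qed
  then obtain W where W: "openin T W" "\<one> \<in> W" "\<forall>z \<in> W \<inter> ?L 0. ?Z z"
    by (elim exE conjE)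
  have "W \<subseteq> carrier G" using openin_subset[OF W(1)] topspace_carrier by simp
  then have "W \<subseteq> {z \<in> carrier G. ?Z z}" using W(3) by (simp only: lower_central_series.simps) blast
  from subgroup_containing_nbhd[OF conn centralizer_subgroup[OF H.subset] W(1,2) this]
  show ?thesis using x h by blast
qed

definition precompact_ray :: "'e \<Rightarrow> bool"
  where "precompact_ray v \<longleftrightarrow> (\<exists>K. compactin T K \<and> (\<forall>t. Exp (t *\<^sub>R v) \<in> K))"

lemma ray_subgroup: "subgroup (range (\<lambda>t. Exp (t *\<^sub>R v))) G"
proof (rule subgroupI)
  fix a assume "a \<in> range (\<lambda>t. Exp (t *\<^sub>R v))"
  then obtain t where "a = Exp (t *\<^sub>R v)" by blast
  then have "inv a = Exp ((- t) *\<^sub>R v)" using Exp_minus[of "t *\<^sub>R v"] by simp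
  then show "inv a \<in> range (\<lambda>t. Exp (t *\<^sub>R v))" by blast
next
  fix a b assume "a \<in> range (\<lambda>t. Exp (t *\<^sub>R v))" "b \<in> range (\<lambda>t. Exp (t *\<^sub>R v))"
  then show "a \<otimes> b \<in> range (\<lambda>t. Exp (t *\<^sub>R v))" by (auto simp flip: Exp_ray_add)
qed auto

lemma compact_product:
  assumes "compactin T K" "compactin T L"
  shows "compactin T {x \<otimes> y | x y. x \<in> K \<and> y \<in> L}"
proof -
  have "compactin (prod_topology T T) (K \<times> L)" using assms by (simp add: compactin_Times)
  from image_compactin[OF this mult_continuous]
  have "compactin T ((\<lambda>(x, y). x \<otimes> y) ` (K \<times> L))" .
  also have "(\<lambda>(x, y). x \<otimes> y) ` (K \<times> L) = {x \<otimes> y | x y. x \<in> K \<and> y \<in> L}" by auto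
  finally show ?thesis .
qed

text \<open>As \<open>Exp\<close> is a homomorphism, its image is a subgroup and thus the whole group. The exponential of the
  span of a finite set lies in a product of compact sets that contain the rays of its elements.\<close>

lemma central_precompact_rays_imp_compact:
  assumes conn: "connected_space T"
    and central: "\<And>v x. x \<in> carrier G \<Longrightarrow> x \<otimes> Exp v = Exp v \<otimes> x"
    and pre: "\<And>v. precompact_ray v"
  shows "compact_space T"
proof -
  have add: "Exp (v + w) = Exp v \<otimes> Exp w" for v w by (rule Exp_add, rule central) auto
  have sub: "subgroup (range Exp) G"
  proof (rule subgroupI)
    show "inv a \<in> range Exp" if "a \<in> range Exp" for a
      using that by (auto simp flip: Exp_minus)
    show "a \<otimes> b \<in> range Exp" if "a \<in> range Exp" "b \<in> range Exp" for a b
      using that by (auto simp flip: add)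
  qed auto
  obtain W where "openin T W" "\<one> \<in> W" "W \<subseteq> range Exp" using Exp_covers_nbhd by blast
  from subgroup_containing_nbhd[OF conn sub this] have range: "range Exp = carrier G" .
  have "\<exists>K. compactin T K \<and> Exp ` span B \<subseteq> K" if "finite B" for B :: "'e set"
    using that
  proof (induction B rule: finite_induct)
    case empty
    then show ?case by (intro exI[of _ "{\<one>}"]) (auto simp: topspace_carrier)
  next
    case (insert b B)
    then obtain K where K: "compactin T K" "Exp ` span B \<subseteq> K" by blast
    obtain L where L: "compactin T L" "\<And>t. Exp (t *\<^sub>R b) \<in> L"
      using pre[of b] unfolding precompact_ray_def by blast
    have "Exp v \<in> {x \<otimes> y | x y. x \<in> K \<and> y \<in> L}" if v: "v \<in> span (insert b B)" for v
    proof -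
      obtain k where k: "v - k *\<^sub>R b \<in> span B" using v span_breakdown_eq by blast
      have "Exp v = Exp (v - k *\<^sub>R b) \<otimes> Exp (k *\<^sub>R b)" using add[of "v - k *\<^sub>R b" "k *\<^sub>R b"] by simp
      then show ?thesis using K(2) L(2) k by blast
    qed
    then show ?case using compact_product[OF K(1) L(1)] by blast
  qed
  from this[of Basis] obtain K where K: "compactin T K" "range Exp \<subseteq> K" by auto
  then have "K = topspace T"
    using compactin_subset_topspace[OF K(1)] range topspace_carrier by auto
  then show ?thesis using K(1) by (simp add: compact_space_def)
qed

text \<open>The precompact rays are central, so the vectors that generate them are closed under addition.
  A linear subspace that contains a ball is everything.\<close>

lemma open_precompact_imp_compact:
  assumes nil: "nilpotent_group G" and conn: "connected_space T"
    and r: "r > 0" and pre: "\<And>v. v \<in> ball v0 r \<Longrightarrow> precompact_ray v"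
  shows "compact_space T"
proof -
  let ?C = "\<lambda>v. \<forall>t. \<forall>x\<in>carrier G. x \<otimes> Exp (t *\<^sub>R v) = Exp (t *\<^sub>R v) \<otimes> x"
  let ?S = "{v. precompact_ray v \<and> ?C v}"
  have central: "?C v" if "precompact_ray v" for v
  proof -
    from that obtain K where K: "compactin T K" "\<forall>t. Exp (t *\<^sub>R v) \<in> K"
      unfolding precompact_ray_def by (elim exE conjE)
    then have sub: "range (\<lambda>t. Exp (t *\<^sub>R v)) \<subseteq> K" by auto
    show ?thesis
      by (intro allI ballI precompact_subgroup_central[OF nil conn ray_subgroup sub K(1)]) auto
  qed
  have add: "v + w \<in> ?S" if v: "v \<in> ?S" and w: "w \<in> ?S" for v w
  proof -
    from v have "precompact_ray v" by simp
    then obtain K where K: "compactin T K" "\<forall>t. Exp (t *\<^sub>R v) \<in> K"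
      unfolding precompact_ray_def by (elim exE conjE)
    from w have "precompact_ray w" by simp
    then obtain L where L: "compactin T L" "\<forall>t. Exp (t *\<^sub>R w) \<in> L"
      unfolding precompact_ray_def by (elim exE conjE)
    have "Exp (t *\<^sub>R (v + w)) = Exp (t *\<^sub>R v) \<otimes> Exp (t *\<^sub>R w)" for t
    proof -
      have "Exp (t *\<^sub>R v + t *\<^sub>R w) = Exp (t *\<^sub>R v) \<otimes> Exp (t *\<^sub>R w)"
        by (rule Exp_add) (use v in auto)
      then show ?thesis by (simp add: scaleR_right_distrib)
    qed
    then have "Exp (t *\<^sub>R (v + w)) \<in> {x \<otimes> y | x y. x \<in> K \<and> y \<in> L}" for t
      using K(2)[THEN spec, of t] L(2)[THEN spec, of t] by (intro CollectI exI conjI)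
    then have pre: "precompact_ray (v + w)"
      unfolding precompact_ray_def using compact_product[OF K(1) L(1)] by (intro exI conjI allI)
    show ?thesis using pre central[OF pre] by (intro CollectI conjI)
  qed
  have scale: "c *\<^sub>R v \<in> ?S" if v: "v \<in> ?S" for c v
  proof -
    from v have "precompact_ray v" by simp
    then obtain K where K: "compactin T K" "\<forall>t. Exp (t *\<^sub>R v) \<in> K"
      unfolding precompact_ray_def by (elim exE conjE)
    have "\<forall>t. Exp (t *\<^sub>R c *\<^sub>R v) \<in> K" using K(2) by simp
    then have pre: "precompact_ray (c *\<^sub>R v)"
      unfolding precompact_ray_def using K(1) by (intro exI conjI)
    show ?thesis using pre central[OF pre] by (intro CollectI conjI)
  qed
  have S: "v \<in> ?S" if "v \<in> ball v0 r" for v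
    using pre[OF that] central[OF pre[OF that]] by (intro CollectI conjI)
  have all: "u \<in> ?S" for u
  proof (cases "u = 0")
    case True
    have "v0 \<in> ball v0 r" using r by simp
    from scale[OF S[OF this], of 0] show ?thesis using True by (simp only: scaleR_zero_left)
  next
    case False
    \<comment> \<open>Every direction \<open>u\<close> is a multiple of a difference of two points of the ball.\<close>
    define c where "c = r / (2 * norm u)"
    have c: "c > 0" using r False by (simp add: c_def)
    have u: "v0 + c *\<^sub>R u \<in> ball v0 r" using r False c by (simp add: dist_norm c_def)
    have "v0 \<in> ball v0 r" using r by simp
    from add[OF S[OF u] scale[OF S[OF this]]]
    have "(v0 + c *\<^sub>R u) + (-1) *\<^sub>R v0 \<in> ?S" .
    then have "inverse c *\<^sub>R ((v0 + c *\<^sub>R u) + (-1) *\<^sub>R v0) \<in> ?S" by (rule scale)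
    moreover have "inverse c *\<^sub>R ((v0 + c *\<^sub>R u) + (-1) *\<^sub>R v0) = u" using c by simp
    ultimately show ?thesis by (simp only:)
  qed
  show ?thesis
  proof (rule central_precompact_rays_imp_compact[OF conn])
    show "x \<otimes> Exp v = Exp v \<otimes> x" if "x \<in> carrier G" for v x
    proof -
      from all[of v, THEN CollectD] have "?C v" by (rule conjunct2)
      from this[THEN spec, of 1, THEN bspec, OF that] show ?thesis unfolding scaleR_one .
    qed
  qed (use all in blast)
qed

end

section \<open>Lie groups in a chart at the identity\<close>

lemma smooth_mapD:
  assumes "smooth_map S A T B f"
  shows "continuous_map S T f"
    and "(U, \<phi>) \<in> A \<Longrightarrow> (V, \<psi>) \<in> B \<Longrightarrow>
      smooth_on (\<phi> ` (U \<inter> f -` V)) (\<psi> \<circ> f \<circ> inv_into U \<phi>)"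
proof -
  show "continuous_map S T f" using assms unfolding smooth_map_def by (elim conjE)
  assume U: "(U, \<phi>) \<in> A" and V: "(V, \<psi>) \<in> B"
  have "\<forall>(U, \<phi>)\<in>A. \<forall>(V, \<psi>)\<in>B. smooth_on (\<phi> ` (U \<inter> f -` V)) (\<psi> \<circ> f \<circ> inv_into U \<phi>)"
    using assms unfolding smooth_map_def by (elim conjE)
  from bspec[OF this U]
  have "\<forall>(V, \<psi>)\<in>B. smooth_on (\<phi> ` (U \<inter> f -` V)) (\<psi> \<circ> f \<circ> inv_into U \<phi>)"
    by (simp only: prod.case)
  from bspec[OF this V] show "smooth_on (\<phi> ` (U \<inter> f -` V)) (\<psi> \<circ> f \<circ> inv_into U \<phi>)"
    by (simp only: prod.case)
qed

context lie_group begin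

lemma
  assumes c: "(U, \<phi>) \<in> A"
  shows chart_domain_open: "openin T U"
    and chart_domain_carrier: "U \<subseteq> carrier G"
    and chart_image_open: "open (\<phi> ` U)"
    and chart_homeomorphic: "homeomorphic_map (subtopology T U) (top_of_set (\<phi> ` U)) \<phi>"
    and chart_inj: "inj_on \<phi> U"
proof -
  have "is_chart T (U, \<phi>)" using manifold c unfolding smooth_manifold_def by blast
  then show U: "openin T U" and "open (\<phi> ` U)"
    and h: "homeomorphic_map (subtopology T U) (top_of_set (\<phi> ` U)) \<phi>"
    by (auto simp: is_chart_def)
  show "U \<subseteq> carrier G" using openin_subset[OF U] topspace_eq by simp
  then show "inj_on \<phi> U"
    using homeomorphic_imp_injective_map[OF h] topspace_eq by (simp add: Int_absorb1)
qed

lemma chart_inverse: "(U, \<phi>) \<in> A \<Longrightarrow> g \<in> U \<Longrightarrow> inv_into U \<phi> (\<phi> g) = g"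
  using chart_inj by (simp add: inv_into_f_f)

lemma chart_image_of_open:
  assumes c: "(U, \<phi>) \<in> A" and W: "openin T W" "W \<subseteq> U"
  shows "open (\<phi> ` W)"
proof -
  have "openin (subtopology T U) W" by (rule subset_openin_subtopology[OF W])
  then have "openin (top_of_set (\<phi> ` U)) (\<phi> ` W)"
    using homeomorphic_imp_open_map[OF chart_homeomorphic[OF c]] by (simp add: open_map_def)
  then show ?thesis using chart_image_open[OF c] by (simp add: openin_open_eq)
qed

lemma chart_preimage_of_open:
  assumes c: "(U, \<phi>) \<in> A" and B: "open B"
  shows "openin T {g \<in> U. \<phi> g \<in> B}"
proof -
  have "continuous_map (subtopology T U) euclidean \<phi>"
    using homeomorphic_imp_continuous_map[OF chart_homeomorphic[OF c]]
    by (simp add: continuous_map_in_subtopology)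
  from openin_continuous_map_preimage[OF this, of B]
  have "openin (subtopology T U) {g \<in> topspace (subtopology T U). \<phi> g \<in> B}" using B by simp
  moreover have "{g \<in> topspace (subtopology T U). \<phi> g \<in> B} = {g \<in> U. \<phi> g \<in> B}"
    using chart_domain_carrier[OF c] topspace_eq by auto
  ultimately show ?thesis using chart_domain_open[OF c] by (simp add: openin_open_subtopology)
qed

lemma transition_smooth:
  assumes "(U, \<phi>) \<in> A" "(V, \<psi>) \<in> A"
  shows "smooth_on (\<phi> ` (U \<inter> V)) (\<psi> \<circ> inv_into U \<phi>)"
proof -
  have "\<forall>(U, \<phi>)\<in>A. \<forall>(V, \<psi>)\<in>A. smooth_on (\<phi> ` (U \<inter> V)) (\<psi> \<circ> inv_into U \<phi>)"
    using manifold unfolding smooth_manifold_def by (elim conjE)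
  from bspec[OF this assms(1)]
  have "\<forall>(V, \<psi>)\<in>A. smooth_on (\<phi> ` (U \<inter> V)) (\<psi> \<circ> inv_into U \<phi>)"
    by (simp only: prod.case)
  from bspec[OF this assms(2)] show ?thesis by (simp only: prod.case)
qed

lemma transition_has_derivative:
  assumes "(U, \<phi>) \<in> A" "(V, \<psi>) \<in> A" "g \<in> U" "g \<in> V"
  shows "((\<psi> \<circ> inv_into U \<phi>) has_derivative
      frechet_derivative (\<psi> \<circ> inv_into U \<phi>) (at (\<phi> g))) (at (\<phi> g))"
  by (rule smooth_on_has_derivative[OF transition_smooth[OF assms(1,2)]]) (use assms in blast)

text \<open>The group multiplication as a function \<open>M\<close> of coordinates. The description by its values on
  images of group elements avoids the inverse of a product chart in later computations.\<close>

lemma mult_in_charts: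
  assumes U: "(U, \<phi>) \<in> A" and V: "(V, \<psi>) \<in> A" and W: "(W, \<theta>) \<in> A"
  shows "\<exists>\<Omega> M. smooth_on \<Omega> M \<and> (\<forall>g\<in>U. \<forall>h\<in>V. g \<otimes> h \<in> W \<longrightarrow> (\<phi> g, \<psi> h) \<in> \<Omega>) \<and>
    (\<forall>g\<in>U. \<forall>h\<in>V. M (\<phi> g, \<psi> h) = \<theta> (g \<otimes> h))"
proof -
  let ?\<Omega> = "map_prod \<phi> \<psi> ` ((U \<times> V) \<inter> (\<lambda>(x, y). x \<otimes> y) -` W)"
  let ?M = "\<theta> \<circ> (\<lambda>(x, y). x \<otimes> y) \<circ> inv_into (U \<times> V) (map_prod \<phi> \<psi>)"
  have "(U \<times> V, map_prod \<phi> \<psi>) \<in> prod_atlas A A" using U V unfolding prod_atlas_def by blast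
  then have sm: "smooth_on ?\<Omega> ?M" by (rule smooth_mapD(2)[OF smooth_mult _ W])
  have inj: "inj_on (map_prod \<phi> \<psi>) (U \<times> V)"
    by (rule map_prod_inj_on[OF chart_inj[OF U] chart_inj[OF V]])
  show ?thesis
  proof (intro exI conjI ballI impI, rule sm)
    show "(\<phi> g, \<psi> h) \<in> ?\<Omega>" if "g \<in> U" "h \<in> V" "g \<otimes> h \<in> W" for g h
      using that by (intro image_eqI[of _ _ "(g, h)"]) auto
    show "?M (\<phi> g, \<psi> h) = \<theta> (g \<otimes> h)" if "g \<in> U" "h \<in> V" for g h
      using inv_into_f_f[OF inj, of "(g, h)"] that by simp
  qed
qed

lemma mult_continuous_map_prod: "continuous_map (prod_topology T T) T (\<lambda>(x, y). x \<otimes> y)"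
  by (rule smooth_mapD(1)[OF smooth_mult])

lemma nbhd_with_products_in:
  assumes U: "openin T U" "\<one> \<in> U"
  shows "\<exists>W. openin T W \<and> \<one> \<in> W \<and> W \<subseteq> U \<and> (\<forall>g\<in>W. \<forall>h\<in>W. g \<otimes> h \<in> U)"
proof -
  let ?P = "{p \<in> topspace (prod_topology T T). (\<lambda>(x, y). x \<otimes> y) p \<in> U}"
  have op: "openin (prod_topology T T) ?P"
    by (rule openin_continuous_map_preimage[OF mult_continuous_map_prod U(1)])
  have mem: "(\<one>, \<one>) \<in> ?P" using U by (simp add: topspace_eq)
  from op[unfolded openin_prod_topology_alt, THEN spec, THEN spec, THEN mp, OF mem]
  obtain X Y where XY: "openin T X" "openin T Y" "\<one> \<in> X" "\<one> \<in> Y" "X \<times> Y \<subseteq> ?P"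
    by (elim exE conjE)
  have "g \<otimes> h \<in> U" if "g \<in> X" "h \<in> Y" for g h using subsetD[OF XY(5), of "(g, h)"] that by simp
  then show ?thesis using XY U by (intro exI[of _ "X \<inter> Y \<inter> U"]) auto
qed

end

locale lie_group_chart = lie_group G T A
  for G :: "('a, 'm) monoid_scheme" (structure)
    and T :: "'a topology"
    and A :: "('a, 'e::euclidean_space) chart set" +
  fixes U :: "'a set" and \<phi> :: "'a \<Rightarrow> 'e"
  assumes chart: "(U, \<phi>) \<in> A" and one_in_chart: "\<one> \<in> U"
begin

abbreviation coord :: "'a \<Rightarrow> 'e" where "coord g \<equiv> \<phi> g - \<phi> \<one>"

text \<open>The derivative of the multiplication at the identity is the addition of tangent vectors, since
  it is the identity on each of the two factors. The rest is strict differentiability of a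
  continuously differentiable map.\<close>

lemma coord_mult_strict:
  assumes e: "\<epsilon> > 0"
  shows "\<exists>\<delta>>0. strict_approx coord (\<otimes>) U \<epsilon> \<delta>"
proof -
  let ?p = "(\<phi> \<one>, \<phi> \<one>)"
  note Uo = chart_domain_open[OF chart] and Uc = chart_domain_carrier[OF chart]
  obtain \<Omega> M where M: "smooth_on \<Omega> M"
    "\<forall>g\<in>U. \<forall>h\<in>U. g \<otimes> h \<in> U \<longrightarrow> (\<phi> g, \<phi> h) \<in> \<Omega>"
    "\<forall>g\<in>U. \<forall>h\<in>U. M (\<phi> g, \<phi> h) = \<phi> (g \<otimes> h)"
    using mult_in_charts[OF chart chart chart] by (elim exE conjE)
  obtain W where W: "openin T W" "\<one> \<in> W" "W \<subseteq> U" "\<forall>g\<in>W. \<forall>h\<in>W. g \<otimes> h \<in> U"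
    using nbhd_with_products_in[OF Uo one_in_chart] by (elim exE conjE)
  have "open (\<phi> ` W)" by (rule chart_image_of_open[OF chart W(1,3)])
  then obtain r where r: "r > 0" "ball (\<phi> \<one>) r \<subseteq> \<phi> ` W"
    using W(2) open_contains_ball by (metis imageI)
  have inW: "g \<in> W" if "g \<in> U" "dist (\<phi> \<one>) (\<phi> g) < r" for g
  proof -
    have "\<phi> g \<in> \<phi> ` W" using that r by auto
    then obtain a where "a \<in> W" "\<phi> g = \<phi> a" by blast
    then show ?thesis using inj_onD[OF chart_inj[OF chart]] that W(3) by blast
  qed
  have sub: "ball ?p r \<subseteq> \<Omega>"
  proof
    fix p assume p: "p \<in> ball ?p r"
    obtain x y where xy: "p = (x, y)" by (cases p)
    have "dist (\<phi> \<one>) x < r" "dist (\<phi> \<one>) y < r"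
      using p dist_fst_le[of ?p p] dist_snd_le[of ?p p] by (auto simp: xy)
    then obtain g h where "g \<in> W" "h \<in> W" "x = \<phi> g" "y = \<phi> h" using r by (metis imageE mem_ball subsetD)
    then show "p \<in> \<Omega>" using M(2) W xy by blast
  qed
  let ?D = "frechet_derivative M (at ?p)"
  have der: "(M has_derivative ?D) (at ?p)"
    by (rule smooth_on_has_derivative[OF M(1)]) (use sub r in auto)
  have D1: "?D (u, 0) = u" for u
  proof -
    have "((\<lambda>x. (x, \<phi> \<one>)) has_derivative (\<lambda>w. (w, 0))) (at (\<phi> \<one>))" by (intro derivative_intros)
    from has_derivative_compose[OF this der]
    have "((\<lambda>x. M (x, \<phi> \<one>)) has_derivative (\<lambda>w. ?D (w, 0))) (at (\<phi> \<one>))" .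
    then have "((\<lambda>x. x) has_derivative (\<lambda>w. ?D (w, 0))) (at (\<phi> \<one>))"
      by (rule has_derivative_transform_within_open[OF _ chart_image_open[OF chart]])
         (use M(3) one_in_chart Uc in auto)
    from has_derivative_unique[OF this has_derivative_ident] show ?thesis by (rule fun_cong)
  qed
  have D2: "?D (0, u) = u" for u
  proof -
    have "((\<lambda>x. (\<phi> \<one>, x)) has_derivative (\<lambda>w. (0, w))) (at (\<phi> \<one>))" by (intro derivative_intros)
    from has_derivative_compose[OF this der]
    have "((\<lambda>x. M (\<phi> \<one>, x)) has_derivative (\<lambda>w. ?D (0, w))) (at (\<phi> \<one>))" .
    then have "((\<lambda>x. x) has_derivative (\<lambda>w. ?D (0, w))) (at (\<phi> \<one>))"
      by (rule has_derivative_transform_within_open[OF _ chart_image_open[OF chart]])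
         (use M(3) one_in_chart Uc in auto)
    from has_derivative_unique[OF this has_derivative_ident] show ?thesis by (rule fun_cong)
  qed
  have D: "?D (u, w) = u + w" for u w
    using linear_add[OF has_derivative_linear[OF der], of "(u, 0)" "(0, w)"] by (simp add: D1 D2)
  have "Ck_on (Suc 0) \<Omega> M" using M(1) by (simp only: smooth_on_def)
  then obtain d where d: "d > 0" "d \<le> r"
    "\<And>x y. x \<in> ball ?p d \<Longrightarrow> y \<in> ball ?p d \<Longrightarrow>
      norm (M x - M y - ?D (x - y)) \<le> \<epsilon> * norm (x - y)"
    using C1_strictly_differentiable[OF _ r(1) sub e] by metis
  have "strict_approx coord (\<otimes>) U \<epsilon> (d / 2)"
    unfolding strict_approx_def
  proof (intro ballI impI)
    fix g h g' h'
    assume U: "g \<in> U" "h \<in> U" "g' \<in> U" "h' \<in> U"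
      and n: "norm (coord g) < d / 2" "norm (coord h) < d / 2"
        "norm (coord g') < d / 2" "norm (coord h') < d / 2"
    have pair: "(x, y) \<in> ball ?p d" if "norm (x - \<phi> \<one>) < d / 2" "norm (y - \<phi> \<one>) < d / 2" for x y
    proof -
      have "dist ?p (x, y) = norm ((x, y) - ?p)" by (subst dist_commute) (rule dist_norm)
      also have "\<dots> = norm (x - \<phi> \<one>, y - \<phi> \<one>)" by simp
      also have "\<dots> \<le> norm (x - \<phi> \<one>) + norm (y - \<phi> \<one>)" by (rule norm_Pair_le)
      finally show ?thesis using that by simp
    qed
    have "g \<in> W" "h \<in> W"
      by (rule inW; use U n d norm_ge_zero in \<open>auto simp: dist_norm norm_minus_commute\<close>)+
    then have prod: "g \<otimes> h \<in> U" using W(4) by blast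
    have "norm (M (\<phi> g, \<phi> h) - M (\<phi> g', \<phi> h') - ?D ((\<phi> g, \<phi> h) - (\<phi> g', \<phi> h')))
        \<le> \<epsilon> * norm ((\<phi> g, \<phi> h) - (\<phi> g', \<phi> h'))"
      by (intro d(3) pair n)
    also have "\<dots> \<le> \<epsilon> * (norm (\<phi> g - \<phi> g') + norm (\<phi> h - \<phi> h'))"
      by (rule mult_left_mono) (use e in \<open>simp_all add: norm_Pair_le\<close>)
    finally have "norm (\<phi> (g \<otimes> h) - \<phi> (g' \<otimes> h') - ((\<phi> g - \<phi> g') + (\<phi> h - \<phi> h')))
        \<le> \<epsilon> * (norm (\<phi> g - \<phi> g') + norm (\<phi> h - \<phi> h'))"
      using U by (simp add: M(3) D)
    then show "g \<otimes> h \<in> U \<and>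
      norm (coord (g \<otimes> h) - coord (g' \<otimes> h') - (coord g - coord g') - (coord h - coord h'))
        \<le> \<epsilon> * (norm (coord g - coord g') + norm (coord h - coord h'))"
      using prod by (simp add: algebra_simps)
  qed
  then show ?thesis using d(1) by (intro exI[of _ "d / 2"]) simp
qed

sublocale coordinate_group G T U coord
proof
  note Uo = chart_domain_open[OF chart] and Uc = chart_domain_carrier[OF chart]
  show "topspace T = carrier G" by (rule topspace_eq)
  show "continuous_map (prod_topology T T) T (\<lambda>(x, y). x \<otimes> y)" by (rule mult_continuous_map_prod)
  show "continuous_map T T (\<lambda>x. inv x)" by (rule smooth_mapD(1)[OF smooth_inv])
  show "\<one> \<in> U" by (rule one_in_chart)
  show "coord \<one> = 0" by simp
  show "inj_on coord U" using chart_inj[OF chart] by (auto simp: inj_on_def)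
  show "\<exists>r>0. ball 0 r \<subseteq> coord ` U"
  proof -
    obtain r where r: "r > 0" "ball (\<phi> \<one>) r \<subseteq> \<phi> ` U"
      using chart_image_open[OF chart] one_in_chart open_contains_ball by (metis imageI)
    have "x \<in> coord ` U" if "x \<in> ball 0 r" for x
    proof -
      have "x + \<phi> \<one> \<in> \<phi> ` U" using that r(2) by (auto simp: dist_norm norm_minus_commute)
      then obtain g where "g \<in> U" "x + \<phi> \<one> = \<phi> g" by blast
      then show ?thesis by (intro image_eqI[of _ _ g]) (auto simp: algebra_simps)
    qed
    then show ?thesis using r(1) by blast
  qed
  show "openin T {g \<in> U. norm (coord g) < \<delta>}" if "\<delta> > 0" for \<delta>
    using chart_preimage_of_open[OF chart open_ball, of "\<phi> \<one>" \<delta>]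
    by (simp add: dist_norm norm_minus_commute)
  show "\<exists>\<delta>>0. {g \<in> U. norm (coord g) < \<delta>} \<subseteq> W" if W: "openin T W" "\<one> \<in> W" for W
  proof -
    have "open (\<phi> ` (W \<inter> U))" by (rule chart_image_of_open[OF chart]) (use W Uo in auto)
    then obtain r where r: "r > 0" "ball (\<phi> \<one>) r \<subseteq> \<phi> ` (W \<inter> U)"
      using W(2) one_in_chart open_contains_ball by (metis IntI imageI)
    have "g \<in> W" if g: "g \<in> U" "norm (coord g) < r" for g
    proof -
      have "\<phi> g \<in> \<phi> ` (W \<inter> U)" using g r by (auto simp: dist_norm norm_minus_commute)
      then obtain a where "a \<in> W \<inter> U" "\<phi> g = \<phi> a" by blast
      then show ?thesis using inj_onD[OF chart_inj[OF chart]] g by blast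
    qed
    then show ?thesis using r(1) by blast
  qed
  show "U \<subseteq> carrier G" by (rule Uc)
  show "\<exists>\<delta>>0. strict_approx coord (\<otimes>) U \<epsilon> \<delta>" if "\<epsilon> > 0" for \<epsilon> by (rule coord_mult_strict[OF that])
qed

end

section \<open>One-parameter subgroups and the density of nonprecompact generators\<close>

lemma one_parameter_subgroupD:
  assumes "one_parameter_subgroup G T A \<gamma>"
  shows "continuous_map euclideanreal T \<gamma>" "\<gamma> (s + t) = \<gamma> s \<otimes>\<^bsub>G\<^esub> \<gamma> t"
    and "(V, \<psi>) \<in> A \<Longrightarrow> smooth_on (\<gamma> -` V) (\<psi> \<circ> \<gamma>)"
proof -
  have sm: "smooth_map euclideanreal real_atlas T A \<gamma>"
    using assms unfolding one_parameter_subgroup_def by (rule conjunct1)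
  show "\<gamma> (s + t) = \<gamma> s \<otimes>\<^bsub>G\<^esub> \<gamma> t"
    using assms unfolding one_parameter_subgroup_def by simp
  show "continuous_map euclideanreal T \<gamma>" by (rule smooth_mapD(1)[OF sm])
  show "smooth_on (\<gamma> -` V) (\<psi> \<circ> \<gamma>)" if "(V, \<psi>) \<in> A"
    using smooth_mapD(2)[OF sm _ that, of UNIV id] by (simp add: real_atlas_def)
qed

lemma one_parameter_subgroupI:
  assumes "continuous_map euclideanreal T \<gamma>" "\<And>s t. \<gamma> (s + t) = \<gamma> s \<otimes>\<^bsub>G\<^esub> \<gamma> t"
    and "\<And>V \<psi>. (V, \<psi>) \<in> A \<Longrightarrow> smooth_on (\<gamma> -` V) (\<psi> \<circ> \<gamma>)"
  shows "one_parameter_subgroup G T A \<gamma>"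
proof -
  have "smooth_on (id ` (UNIV \<inter> \<gamma> -` V)) (\<psi> \<circ> \<gamma> \<circ> inv_into UNIV id)" if "(V, \<psi>) \<in> A" for V \<psi>
    using assms(3)[OF that] by simp
  then have "smooth_map euclideanreal real_atlas T A \<gamma>"
    unfolding smooth_map_def real_atlas_def using assms(1) by auto
  then show ?thesis unfolding one_parameter_subgroup_def using assms(2) by simp
qed

context lie_group_chart begin

text \<open>In a chart \<open>\<psi>\<close>, differentiating \<open>\<gamma> (t + s) = \<gamma> t \<otimes> \<gamma> s\<close> in \<open>s\<close> at \<open>0\<close> shows that the curve
  is an integral curve of the left-invariant vector field with value \<open>v\<close> at the identity. The field is a
  partial derivative of the multiplication and therefore smooth.\<close>

lemma Exp_ray_one_parameter_subgroup: "one_parameter_subgroup G T A (\<lambda>t. Exp (t *\<^sub>R v))"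
proof (rule one_parameter_subgroupI[OF Exp_ray_continuous Exp_ray_add])
  fix V \<psi> assume V: "(V, \<psi>) \<in> A"
  let ?\<gamma> = "\<lambda>t. Exp (t *\<^sub>R v)"
  obtain \<Omega> M where M: "smooth_on \<Omega> M"
    "\<forall>g\<in>V. \<forall>h\<in>U. g \<otimes> h \<in> V \<longrightarrow> (\<psi> g, \<phi> h) \<in> \<Omega>"
    "\<forall>g\<in>V. \<forall>h\<in>U. M (\<psi> g, \<phi> h) = \<psi> (g \<otimes> h)"
    using mult_in_charts[OF V chart V] by (elim exE conjE)
  have mem: "(u, \<phi> \<one>) \<in> \<Omega>" if u: "u \<in> \<psi> ` V" for u
  proof -
    obtain g where g: "g \<in> V" "u = \<psi> g" using u by blast
    moreover have "g \<otimes> \<one> \<in> V" using g chart_domain_carrier[OF V] by (simp add: subset_iff)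
    ultimately show ?thesis using M(2) one_in_chart by blast
  qed
  let ?F = "\<lambda>u. frechet_derivative M (at (u, \<phi> \<one>)) (0, v)"
  have F: "smooth_on (\<psi> ` V) ?F"
    by (rule smooth_on_slice[OF chart_image_open[OF V] mem smooth_on_directional_derivative[OF M(1)]])
  have op: "open (?\<gamma> -` V)"
    using openin_continuous_map_preimage[OF Exp_ray_continuous chart_domain_open[OF V]]
    by (simp add: vimage_def)
  show "smooth_on (?\<gamma> -` V) (\<psi> \<circ> ?\<gamma>)"
  proof (rule integral_curve_smooth[OF op chart_image_open[OF V] _ F])
    show "(\<psi> \<circ> ?\<gamma>) t \<in> \<psi> ` V" if "t \<in> ?\<gamma> -` V" for t using that by auto
    fix t assume t: "t \<in> ?\<gamma> -` V"
    then have tV: "?\<gamma> t \<in> V" by simp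
    let ?u = "\<psi> (?\<gamma> t)"
    have "((\<lambda>s. \<phi> (?\<gamma> s)) has_vector_derivative v) (at 0)"
      using Exp_ray_has_vector_derivative[of v] by (simp add: has_vector_derivative_diff_const)
    then have 1: "((\<lambda>s. (?u, \<phi> (?\<gamma> s))) has_derivative (\<lambda>s. (0, s *\<^sub>R v))) (at 0)"
      unfolding has_vector_derivative_def by (intro has_derivative_Pair has_derivative_const)
    have DM: "(M has_derivative frechet_derivative M (at (?u, \<phi> \<one>))) (at (?u, \<phi> (?\<gamma> 0)))"
      using smooth_on_has_derivative[OF M(1) mem] tV by simp
    have "((\<lambda>s. M (?u, \<phi> (?\<gamma> s))) has_derivative
        (\<lambda>s. frechet_derivative M (at (?u, \<phi> \<one>)) (0, s *\<^sub>R v))) (at 0)"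
      by (rule has_derivative_compose[OF 1 DM])
    moreover have "frechet_derivative M (at (?u, \<phi> \<one>)) (0, s *\<^sub>R v) = s *\<^sub>R ?F ?u" for s
      using linear_scale[OF has_derivative_linear[OF DM], of s "(0, v)"] by simp
    ultimately have 2: "((\<lambda>s. M (?u, \<phi> (?\<gamma> s))) has_derivative (\<lambda>s. s *\<^sub>R ?F ?u)) (at 0)"
      by simp
    obtain e where e: "e > 0" "\<And>s. \<bar>s\<bar> < e \<Longrightarrow> ?\<gamma> s \<in> U"
    proof -
      have "open (?\<gamma> -` U)"
        using openin_continuous_map_preimage[OF Exp_ray_continuous chart_domain_open[OF chart]]
        by (simp add: vimage_def)
      moreover have "0 \<in> ?\<gamma> -` U" using one_in_chart by simp
      ultimately obtain e where "e > 0" "ball 0 e \<subseteq> ?\<gamma> -` U" using open_contains_ball by blast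
      then show thesis by (intro that[of e]) (auto simp: subset_iff dist_real_def)
    qed
    have 3: "((\<lambda>s. \<psi> (?\<gamma> (t + s))) has_derivative (\<lambda>s. s *\<^sub>R ?F ?u)) (at 0)"
    proof (rule has_derivative_transform_within_open[OF 2 open_ball[of 0 e]])
      fix s :: real assume "s \<in> ball 0 e"
      then have "?\<gamma> s \<in> U" using e(2) by (simp add: dist_real_def)
      then show "M (?u, \<phi> (?\<gamma> s)) = \<psi> (?\<gamma> (t + s))" using M(3) tV by (simp add: Exp_ray_add)
    qed (use e in auto)
    have "((\<lambda>x. x - t) has_derivative (\<lambda>s. s)) (at t)" by (auto intro!: derivative_eq_intros)
    from has_derivative_compose[OF this, of "\<lambda>s. \<psi> (?\<gamma> (t + s))"] 3
    have "((\<lambda>x. \<psi> (?\<gamma> (t + (x - t)))) has_derivative (\<lambda>s. s *\<^sub>R ?F ?u)) (at t)" by simp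
    then show "((\<psi> \<circ> ?\<gamma>) has_vector_derivative ?F ((\<psi> \<circ> ?\<gamma>) t)) (at t)"
      unfolding has_vector_derivative_def by (simp add: o_def)
  qed
qed

lemma tangent_component:
  assumes X: "X \<in> lie_algebra G A"
  shows "(V, \<psi>) \<in> A \<Longrightarrow> \<one> \<in> V \<Longrightarrow>
      X (V, \<psi>) = frechet_derivative (\<psi> \<circ> inv_into U \<phi>) (at (\<phi> \<one>)) (X (U, \<phi>))"
    and "\<not> (c \<in> A \<and> \<one> \<in> fst c) \<Longrightarrow> X c = 0"
proof -
  have X12: "(\<forall>c. \<not> (c \<in> A \<and> \<one> \<in> fst c) \<longrightarrow> X c = 0) \<and> (\<forall>(U, \<phi>)\<in>A. \<forall>(V, \<psi>)\<in>A. \<one> \<in> U \<and> \<one> \<in> V \<longrightarrow>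
      X (V, \<psi>) = frechet_derivative (\<psi> \<circ> inv_into U \<phi>) (at (\<phi> \<one>)) (X (U, \<phi>)))"
    using X unfolding lie_algebra_def tangent_space_def mem_Collect_eq .
  note X2 = X12[THEN conjunct2] and X1 = X12[THEN conjunct1]
  show "X c = 0" if "\<not> (c \<in> A \<and> \<one> \<in> fst c)" using X1 that by blast
  assume V: "(V, \<psi>) \<in> A" "\<one> \<in> V"
  from bspec[OF X2 chart] have "\<forall>(V, \<psi>)\<in>A. \<one> \<in> U \<and> \<one> \<in> V \<longrightarrow>
      X (V, \<psi>) = frechet_derivative (\<psi> \<circ> inv_into U \<phi>) (at (\<phi> \<one>)) (X (U, \<phi>))"
    by (simp only: prod.case)
  from bspec[OF this V(1)] show "X (V, \<psi>) = frechet_derivative (\<psi> \<circ> inv_into U \<phi>) (at (\<phi> \<one>)) (X (U, \<phi>))"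
    using V(2) one_in_chart by (simp only: prod.case)
qed

lemma Exp_ray_velocity:
  assumes X: "X \<in> lie_algebra G A"
  shows "velocity A (\<lambda>t. Exp (t *\<^sub>R X (U, \<phi>))) 0 = X"
proof
  fix c :: "('a, 'e) chart"
  let ?\<gamma> = "\<lambda>t. Exp (t *\<^sub>R X (U, \<phi>))"
  obtain V \<psi> where c: "c = (V, \<psi>)" by (cases c)
  show "velocity A ?\<gamma> 0 c = X c"
  proof (cases "(V, \<psi>) \<in> A \<and> \<one> \<in> V")
    case False
    then show ?thesis using tangent_component(2)[OF X, of c] by (auto simp: velocity_def c)
  next
    case True
    let ?D = "frechet_derivative (\<psi> \<circ> inv_into U \<phi>) (at (\<phi> \<one>))"
    have D: "((\<psi> \<circ> inv_into U \<phi>) has_derivative ?D) (at (\<phi> \<one>))"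
      using transition_has_derivative[OF chart _ one_in_chart] True by blast
    have "((\<lambda>s. \<phi> (?\<gamma> s)) has_vector_derivative X (U, \<phi>)) (at 0)"
      using Exp_ray_has_vector_derivative[of "X (U, \<phi>)"] by (simp add: has_vector_derivative_diff_const)
    then have "((\<lambda>s. \<phi> (?\<gamma> s)) has_derivative (\<lambda>s. s *\<^sub>R X (U, \<phi>))) (at 0)"
      by (simp add: has_vector_derivative_def)
    from has_derivative_compose[OF this, of "\<psi> \<circ> inv_into U \<phi>" ?D] D
    have "((\<lambda>s. (\<psi> \<circ> inv_into U \<phi>) (\<phi> (?\<gamma> s))) has_derivative (\<lambda>s. ?D (s *\<^sub>R X (U, \<phi>)))) (at 0)"
      by simp
    then have "((\<psi> \<circ> ?\<gamma>) has_derivative (\<lambda>s. ?D (s *\<^sub>R X (U, \<phi>)))) (at 0)"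
    proof (rule has_derivative_transform_within_open)
      show "open (?\<gamma> -` U)"
        using openin_continuous_map_preimage[OF Exp_ray_continuous chart_domain_open[OF chart]]
        by (simp add: vimage_def)
    qed (use one_in_chart chart_inverse[OF chart] in auto)
    moreover have "?D (s *\<^sub>R X (U, \<phi>)) = s *\<^sub>R X (V, \<psi>)" for s
      using linear_scale[OF has_derivative_linear[OF D]] tangent_component(1)[OF X] True by simp
    ultimately have "((\<psi> \<circ> ?\<gamma>) has_vector_derivative X (V, \<psi>)) (at 0)"
      by (simp add: has_vector_derivative_def)
    then show ?thesis using True by (simp add: velocity_def c vector_derivative_at)
  qed
qed

lemma one_parameter_subgroup_eq_Exp_ray:
  assumes \<gamma>: "one_parameter_subgroup G T A \<gamma>"
  shows "\<gamma> = (\<lambda>t. Exp (t *\<^sub>R velocity A \<gamma> 0 (U, \<phi>)))"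
proof
  fix t
  have carrier: "\<gamma> t \<in> carrier G" for t
    using one_parameter_subgroupD(1)[OF \<gamma>] topspace_eq unfolding continuous_map_def by auto
  note add = one_parameter_subgroupD(2)[OF \<gamma>]
  have zero: "\<gamma> 0 = \<one>" using add[of 0 0] carrier[of 0] by simp
  have "open (\<gamma> -` U)"
    using openin_continuous_map_preimage[OF one_parameter_subgroupD(1)[OF \<gamma>] chart_domain_open[OF chart]]
    by (simp add: vimage_def)
  moreover have 0: "0 \<in> \<gamma> -` U" using zero one_in_chart by simp
  ultimately have ev: "\<forall>\<^sub>F t in at 0. \<gamma> t \<in> U"
    by (auto simp: eventually_at_topological intro!: exI[of _ "\<gamma> -` U"])
  have "(\<phi> \<circ> \<gamma>) differentiable (at 0)"
    using smooth_on_has_derivative[OF one_parameter_subgroupD(3)[OF \<gamma> chart] 0] by (rule differentiableI)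
  then have "((\<phi> \<circ> \<gamma>) has_vector_derivative velocity A \<gamma> 0 (U, \<phi>)) (at 0)"
    using chart one_in_chart zero by (simp add: vector_derivative_works velocity_def)
  then have "((\<lambda>t. coord (\<gamma> t)) has_vector_derivative velocity A \<gamma> 0 (U, \<phi>)) (at 0)"
    by (simp add: has_vector_derivative_diff_const o_def)
  from Exp_unique[OF carrier add ev this] show "\<gamma> t = Exp (t *\<^sub>R velocity A \<gamma> 0 (U, \<phi>))" .
qed

lemma lie_exp_eq_Exp:
  assumes X: "X \<in> lie_algebra G A"
  shows "lie_exp G T A X = Exp (X (U, \<phi>))"
proof -
  let ?\<gamma> = "\<lambda>t. Exp (t *\<^sub>R X (U, \<phi>))"
  have "(THE \<gamma>. one_parameter_subgroup G T A \<gamma> \<and> velocity A \<gamma> 0 = X) = ?\<gamma>"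
  proof (rule the_equality)
    show "one_parameter_subgroup G T A ?\<gamma> \<and> velocity A ?\<gamma> 0 = X"
      using Exp_ray_one_parameter_subgroup Exp_ray_velocity[OF X] by blast
    show "\<gamma> = ?\<gamma>" if "one_parameter_subgroup G T A \<gamma> \<and> velocity A \<gamma> 0 = X" for \<gamma>
      using one_parameter_subgroup_eq_Exp_ray that by blast
  qed
  then show ?thesis unfolding lie_exp_def by simp
qed

text \<open>The inverse of the evaluation of tangent vectors at the identity in the fixed chart.\<close>

definition tangent_of :: "'e \<Rightarrow> ('a, 'e) tangent_vector"
  where "tangent_of v = (\<lambda>(V, \<psi>). if (V, \<psi>) \<in> A \<and> \<one> \<in> V
      then frechet_derivative (\<psi> \<circ> inv_into U \<phi>) (at (\<phi> \<one>)) v else 0)"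

text \<open>The chain rule for the transition maps at the identity, which makes the derivatives of the
  transitions from the fixed chart a compatible family.\<close>

lemma transition_chain:
  assumes V: "(V, \<psi>) \<in> A" "\<one> \<in> V" and W: "(W, \<theta>) \<in> A" "\<one> \<in> W"
  shows "frechet_derivative (\<theta> \<circ> inv_into U \<phi>) (at (\<phi> \<one>)) v
    = frechet_derivative (\<theta> \<circ> inv_into V \<psi>) (at (\<psi> \<one>))
        (frechet_derivative (\<psi> \<circ> inv_into U \<phi>) (at (\<phi> \<one>)) v)"
proof -
  let ?f = "\<psi> \<circ> inv_into U \<phi>" and ?g = "\<theta> \<circ> inv_into V \<psi>"
  have f: "(?f has_derivative frechet_derivative ?f (at (\<phi> \<one>))) (at (\<phi> \<one>))"
    by (rule transition_has_derivative[OF chart V(1) one_in_chart V(2)])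
  have "?f (\<phi> \<one>) = \<psi> \<one>" using chart_inverse[OF chart one_in_chart] by simp
  then have g: "(?g has_derivative frechet_derivative ?g (at (\<psi> \<one>))) (at (?f (\<phi> \<one>)))"
    using transition_has_derivative[OF V(1) W(1) V(2) W(2)] by simp
  have "((\<lambda>x. ?g (?f x)) has_derivative (\<lambda>v. frechet_derivative ?g (at (\<psi> \<one>))
      (frechet_derivative ?f (at (\<phi> \<one>)) v))) (at (\<phi> \<one>))"
    by (rule has_derivative_compose[OF f g])
  moreover have "open (\<phi> ` (U \<inter> V))"
    by (rule chart_image_of_open[OF chart])
       (use chart_domain_open[OF chart] chart_domain_open[OF V(1)] in auto)
  moreover have "\<phi> \<one> \<in> \<phi> ` (U \<inter> V)" using V one_in_chart by blast
  moreover have "?g (?f x) = (\<theta> \<circ> inv_into U \<phi>) x" if "x \<in> \<phi> ` (U \<inter> V)" for x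
    using that chart_inverse[OF chart] chart_inverse[OF V(1)] by auto
  ultimately have "((\<theta> \<circ> inv_into U \<phi>) has_derivative (\<lambda>v. frechet_derivative ?g (at (\<psi> \<one>))
      (frechet_derivative ?f (at (\<phi> \<one>)) v))) (at (\<phi> \<one>))"
    by (rule has_derivative_transform_within_open)
  from frechet_derivative_at[OF this] show ?thesis by metis
qed

lemma tangent_of_in_lie_algebra: "tangent_of v \<in> lie_algebra G A"
  unfolding lie_algebra_def tangent_space_def mem_Collect_eq
proof (intro conjI allI impI)
  show "tangent_of v c = 0" if "\<not> (c \<in> A \<and> \<one> \<in> fst c)" for c
    using that by (cases c) (auto simp: tangent_of_def)
  show "\<forall>(V, \<psi>)\<in>A. \<forall>(W, \<theta>)\<in>A. \<one> \<in> V \<and> \<one> \<in> W \<longrightarrow> tangent_of v (W, \<theta>) =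
      frechet_derivative (\<theta> \<circ> inv_into V \<psi>) (at (\<psi> \<one>)) (tangent_of v (V, \<psi>))"
  proof (clarify)
    fix V \<psi> W \<theta> assume "(V, \<psi>) \<in> A" "(W, \<theta>) \<in> A" "\<one> \<in> V" "\<one> \<in> W"
    then show "tangent_of v (W, \<theta>) =
      frechet_derivative (\<theta> \<circ> inv_into V \<psi>) (at (\<psi> \<one>)) (tangent_of v (V, \<psi>))"
      using transition_chain[of V \<psi> W \<theta> v] by (simp add: tangent_of_def)
  qed
qed

lemma tangent_of_component:
  assumes X: "X \<in> lie_algebra G A"
  shows "tangent_of (X (U, \<phi>)) = X"
proof
  fix c :: "('a, 'e) chart"
  obtain V \<psi> where c: "c = (V, \<psi>)" by (cases c)
  show "tangent_of (X (U, \<phi>)) c = X c"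
    using tangent_component(1)[OF X, of V \<psi>] tangent_component(2)[OF X, of c]
    by (auto simp: tangent_of_def c)
qed

lemma component_tangent_of: "tangent_of v (U, \<phi>) = v"
proof -
  have "((\<lambda>x. x) has_derivative (\<lambda>v. v)) (at (\<phi> \<one>))" by (rule has_derivative_ident)
  then have "((\<phi> \<circ> inv_into U \<phi>) has_derivative (\<lambda>v. v)) (at (\<phi> \<one>))"
    by (rule has_derivative_transform_within_open[OF _ chart_image_open[OF chart]])
       (use one_in_chart chart_inverse[OF chart] in auto)
  from frechet_derivative_at[OF this] have "frechet_derivative (\<phi> \<circ> inv_into U \<phi>) (at (\<phi> \<one>)) = (\<lambda>v. v)" by simp
  then show ?thesis using chart one_in_chart by (simp add: tangent_of_def)
qed

lemma tangent_of_bounded_linear: "bounded_linear (\<lambda>v. tangent_of v c)"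
proof (cases c)
  case (Pair V \<psi>)
  show ?thesis
  proof (cases "(V, \<psi>) \<in> A \<and> \<one> \<in> V")
    case True
    then have "bounded_linear (frechet_derivative (\<psi> \<circ> inv_into U \<phi>) (at (\<phi> \<one>)))"
      using transition_has_derivative[OF chart _ one_in_chart] has_derivative_bounded_linear by blast
    then show ?thesis using True by (simp add: tangent_of_def Pair)
  qed (auto simp: tangent_of_def Pair)
qed

lemma scale_tangent_of: "scale_tangent t (tangent_of v) = tangent_of (t *\<^sub>R v)"
  unfolding scale_tangent_def
  by (rule ext) (simp add: linear_scale[OF bounded_linear.linear[OF tangent_of_bounded_linear]])

lemma tangent_of_continuous: "continuous_on UNIV tangent_of"
  by (intro continuous_on_coordinatewise_then_product linear_continuous_on tangent_of_bounded_linear)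

lemma lie_exp_tangent_of: "lie_exp G T A (scale_tangent t (tangent_of v)) = Exp (t *\<^sub>R v)"
  unfolding scale_tangent_of lie_exp_eq_Exp[OF tangent_of_in_lie_algebra] component_tangent_of ..

lemma not_nonprecompact_imp_precompact_ray:
  assumes "\<not> nonprecompact_generator G T A (tangent_of v)"
  shows "precompact_ray v"
proof -
  let ?R = "range (\<lambda>t. Exp (t *\<^sub>R v))"
  have "compactin T (T closure_of ?R)"
    using assms unfolding nonprecompact_generator_def lie_exp_tangent_of by simp
  moreover have "?R \<subseteq> T closure_of ?R"
    by (rule closure_of_subset) (auto simp: topspace_eq)
  ultimately show ?thesis unfolding precompact_ray_def by blast
qed

text \<open>Otherwise \<open>tangent_of\<close> pulls \<open>W\<close> back to a neighbourhood of the coordinates of \<open>X\<close> that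
  consists of vectors with precompact rays.\<close>

lemma nonprecompact_generators_dense:
  assumes conn: "connected_space T" and nc: "\<not> compact_space T" and nil: "nilpotent_group G"
    and X: "X \<in> lie_algebra G A" and W: "open W" "X \<in> W"
  shows "\<exists>Y \<in> lie_algebra G A \<inter> W. nonprecompact_generator G T A Y"
proof (rule ccontr)
  assume contra: "\<not> ?thesis"
  let ?v = "X (U, \<phi>)"
  have "open (tangent_of -` W)"
    using tangent_of_continuous W(1) by (simp add: continuous_on_open_vimage)
  moreover have "?v \<in> tangent_of -` W" using W(2) by (simp add: tangent_of_component[OF X])
  ultimately obtain r where r: "r > 0" "ball ?v r \<subseteq> tangent_of -` W"
    using open_contains_ball by blast
  have "precompact_ray v" if "v \<in> ball ?v r" for v
    using not_nonprecompact_imp_precompact_ray[of v] contra tangent_of_in_lie_algebra[of v] that r(2)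
    by blast
  then have "compact_space T" by (rule open_precompact_imp_compact[OF nil conn r(1)])
  then show False using nc by blast
qed

end

theorem lemma3p5:
  fixes N :: "('a, 'm) monoid_scheme"
    and T :: "'a topology"
    and A :: "('a, 'e::euclidean_space) chart set"
  assumes "lie_group N T A"
    and "connected_space T"
    and "\<not> compact_space T"
    and "nilpotent_group N"
  shows "top_of_set (lie_algebra N A) closure_of
           {X \<in> lie_algebra N A. nonprecompact_generator N T A X} = lie_algebra N A"
proof -
  interpret lie_group N T A by fact
  have "\<one>\<^bsub>N\<^esub> \<in> \<Union> (fst ` A)"
    using manifold topspace_eq unfolding smooth_manifold_def by auto
  then obtain U \<phi> where c: "(U, \<phi>) \<in> A" "\<one>\<^bsub>N\<^esub> \<in> U" by force
  interpret lie_group_chart N T A U \<phi> by unfold_locales (rule c)+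
  let ?S = "{X \<in> lie_algebra N A. nonprecompact_generator N T A X}"
  have "X \<in> top_of_set (lie_algebra N A) closure_of ?S" if X: "X \<in> lie_algebra N A" for X
    unfolding in_closure_of
  proof (intro conjI allI impI)
    show "X \<in> topspace (top_of_set (lie_algebra N A))" using X by simp
    fix S assume S: "X \<in> S \<and> openin (top_of_set (lie_algebra N A)) S"
    then obtain W where W: "open W" "S = lie_algebra N A \<inter> W" unfolding openin_open by blast
    then show "\<exists>Y. Y \<in> ?S \<and> Y \<in> S"
      using nonprecompact_generators_dense[OF assms(2-4) X W(1)] S by blast
  qed
  moreover have "top_of_set (lie_algebra N A) closure_of ?S \<subseteq> lie_algebra N A"
    using closure_of_subset_topspace[of "top_of_set (lie_algebra N A)"] by simp
  ultimately show ?thesis by blast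
qed

end
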